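(* Let $V$ be a linear subspace of $\mathscr L_1(E,\mu)\cap\mathscr L_2(E,\mu)$ such that $(V,\|\cdot\|_{\mu,2})$ is a Hilbert space of functions and, for some $R>0$, $\|t\|_\infty\le R\|t\|_{\mu,2}$ for all $t\in V$. Let $\mathcal M$ be an at most countable nonempty subset of $V$ and $\mathscr M=\{p\cdot\mu,\ p\in\mathcal M\}$. Let $X_1,\ldots,X_n$ be independent, $X_i$ having a density $p_i^\star\in\mathscr L_2(E,\mu)$ with respect to $\mu$. Then any $\ell_2$-estimator $\widehat P=\widehat p\cdot\mu$ based on $\mathcal M$ satisfies, for all $\xi>0$, with probability at least $1-e^{-\xi}$, $$\frac1n\sum_{i=1}^n\|p_i^\star-\widehat p\|_{\mu,2}\le5\inf_{p\in\mathcal M}\frac1n\sum_{i=1}^n\|p_i^\star-p\|_{\mu,2}+\frac{4R}{\sqrt n}\left[1+\sqrt{2\xi}+\frac{\epsilon}{\sqrt n}\right].$$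
   Context: $(E,\mathcal E,\mu)$ is a measure space with $\mu$ $\sigma$-finite. $\mathscr L_j(E,\mu)$ is the set of measurable functions $f$ with $\|f\|_{\mu,j}=(\int|f|^jd\mu)^{1/j}<\infty$, and $\|f\|_\infty=\sup_{x\in E}|f(x)|$. Elements of $\mathcal M$ need not be probability densities. $\ell_2$-estimator: for $P=p\cdot\mu,\ Q=q\cdot\mu\in\mathscr M$ let $f_{(P,Q)}=(p-q)/\|p-q\|_{\mu,2}$ if $P\ne Q$, $f_{(P,P)}=0$, and $$t_{(P,Q)}=\frac1{2R}\left[\int_Ef_{(P,Q)}\frac{dP+dQ}{2}-f_{(P,Q)}\right].$$ Put $\mathbf T(\boldsymbol X,P)=\sup_{Q\in\mathscr M}\sum_{i=1}^nt_{(P,Q)}(X_i)$. Given a fixed $\epsilon>0$, an $\ell_2$-estimator based on $\mathcal M$ is any (measurable) random element $\widehat P$ of $\mathscr M$ with $\mathbf T(\boldsymbol X,\widehat P)\le\inf_{P\in\mathscr M}\mathbf T(\boldsymbol X,P)+\epsilon$. *)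

theory Defs
  imports "HOL-Probability.Probability" "HOL-Library.Function_Algebras"
begin

definition Lnorm :: "'a measure \<Rightarrow> nat \<Rightarrow> ('a \<Rightarrow> real) \<Rightarrow> real" where
  "Lnorm \<mu> j f = root j (\<integral>x. \<bar>f x\<bar> ^ j \<partial>\<mu>)"

text \<open>Elements are functions, not classes of functions modulo almost everywhere equality.\<close>

definition Lspace :: "'a measure \<Rightarrow> nat \<Rightarrow> ('a \<Rightarrow> real) set" where
  "Lspace \<mu> j = {f \<in> borel_measurable \<mu>. integrable \<mu> (\<lambda>x. \<bar>f x\<bar> ^ j)}"

definition supnorm :: "'a measure \<Rightarrow> ('a \<Rightarrow> real) \<Rightarrow> ereal" where
  "supnorm \<mu> f = (SUP x\<in>space \<mu>. ereal \<bar>f x\<bar>)"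

definition linear_subspace :: "('a \<Rightarrow> real) set \<Rightarrow> bool" where
  "linear_subspace V \<longleftrightarrow> module.subspace (\<lambda>c f x. c * f x) V"

text \<open>
  Meant for linear subspaces of square integrable functions, where the norm comes from the
  inner product \<open>\<integral>x. f x * g x \<partial>\<mu>\<close>; what remains to be required of a Hilbert space is that
  this norm separates the elements of \<open>V\<close> and that \<open>V\<close> is complete.
  Functions on \<open>space \<mu>\<close> are total functions here, so separation also makes \<open>V\<close> contain at
  most one representative of each function on \<open>space \<mu>\<close> (for instance the one vanishing
  outside \<open>space \<mu>\<close>).
\<close>

definition L2_hilbert :: "'a measure \<Rightarrow> ('a \<Rightarrow> real) set \<Rightarrow> bool" where
  "L2_hilbert \<mu> V \<longleftrightarrow>
     Metric_space V (\<lambda>f g. Lnorm \<mu> 2 (\<lambda>x. f x - g x)) \<and>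
     Metric_space.mcomplete V (\<lambda>f g. Lnorm \<mu> 2 (\<lambda>x. f x - g x))"

text \<open>
  The finite signed measure with density \<open>p\<close>, as a set function. The library constant
  \<open>density\<close> does not apply because \<open>p\<close> may take negative values.
\<close>

type_synonym 'a smeasure = "'a set \<Rightarrow> real"

definition sdensity :: "'a measure \<Rightarrow> ('a \<Rightarrow> real) \<Rightarrow> 'a smeasure" where
  "sdensity \<mu> p = (\<lambda>A\<in>sets \<mu>. LINT x:A|\<mu>. p x)"

text \<open>The density in \<open>M\<close> of an element of \<open>sdensity \<mu> ` M\<close>.\<close>

definition dens :: "'a measure \<Rightarrow> ('a \<Rightarrow> real) set \<Rightarrow> 'a smeasure \<Rightarrow> 'a \<Rightarrow> real" where
  "dens \<mu> M P = inv_into M (sdensity \<mu>) P"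

definition l2_f ::
  "'a measure \<Rightarrow> ('a \<Rightarrow> real) set \<Rightarrow> 'a smeasure \<Rightarrow> 'a smeasure \<Rightarrow> 'a \<Rightarrow> real" where
  "l2_f \<mu> M P Q x =
     (if P = Q then 0
      else (dens \<mu> M P x - dens \<mu> M Q x) / Lnorm \<mu> 2 (\<lambda>y. dens \<mu> M P y - dens \<mu> M Q y))"

text \<open>The integral of \<open>f\<close> against \<open>(P + Q) / 2\<close> is that of \<open>f * (p + q) / 2\<close> against \<open>\<mu>\<close>.\<close>

definition l2_t ::
  "'a measure \<Rightarrow> ('a \<Rightarrow> real) set \<Rightarrow> real \<Rightarrow> 'a smeasure \<Rightarrow> 'a smeasure \<Rightarrow> 'a \<Rightarrow> real" where
  "l2_t \<mu> M R P Q x =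
     1 / (2 * R) *
       ((\<integral>y. l2_f \<mu> M P Q y * ((dens \<mu> M P y + dens \<mu> M Q y) / 2) \<partial>\<mu>) - l2_f \<mu> M P Q x)"

definition l2_T ::
  "'a measure \<Rightarrow> ('a \<Rightarrow> real) set \<Rightarrow> real \<Rightarrow> nat \<Rightarrow> (nat \<Rightarrow> 'a) \<Rightarrow> 'a smeasure \<Rightarrow> ereal" where
  "l2_T \<mu> M R n x P = (SUP Q\<in>sdensity \<mu> ` M. ereal (\<Sum>i=1..n. l2_t \<mu> M R P Q (x i)))"

text \<open>
  The model is countable and carries its discrete sigma-algebra, which is also the Borel
  sigma-algebra of the \<open>L2\<close> distance between densities. The estimator lives on the
  underlying probability space \<open>\<Omega>\<close>; it may, but need not, be a function of the observations.
\<close>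

definition l2_estimator ::
  "'w measure \<Rightarrow> 'a measure \<Rightarrow> ('a \<Rightarrow> real) set \<Rightarrow> real \<Rightarrow> real \<Rightarrow> nat \<Rightarrow> (nat \<Rightarrow> 'w \<Rightarrow> 'a)
    \<Rightarrow> ('w \<Rightarrow> 'a smeasure) \<Rightarrow> bool" where
  "l2_estimator \<Omega> \<mu> M R \<epsilon> n X Phat \<longleftrightarrow>
     Phat \<in> measurable \<Omega> (count_space (sdensity \<mu> ` M)) \<and>
     (\<forall>\<omega>\<in>space \<Omega>. l2_T \<mu> M R n (\<lambda>i. X i \<omega>) (Phat \<omega>)
        \<le> (INF P\<in>sdensity \<mu> ` M. l2_T \<mu> M R n (\<lambda>i. X i \<omega>) P) + ereal \<epsilon>)"

end

theory Submission
  imports Defs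
begin

text \<open>
  For densities \<open>p\<close> and \<open>q\<close> of the model, the statistic of the test between them has an expectation that
  compares the distances of \<open>p\<close> and \<open>q\<close> to the true densities: up to the factor \<open>2 * R\<close> it lies below
  \<open>3 / 2 * S p - 1 / 2 * S q\<close>, where \<open>S\<close> is the sum of the \<open>L2\<close> distances to the true densities
  (\<open>unit_diff_inner_le\<close>). This only uses the Cauchy-Schwarz and the triangle inequality.

  Suppose that, for a fixed \<open>p\<close>, these statistics exceed their expectations by at most
  \<open>c / (2 * R)\<close>, simultaneously in \<open>q\<close>. As the tests are antisymmetric in \<open>p\<close> and \<open>q\<close>, and as the estimator nearly
  minimises the supremum of its test statistics, the estimated density \<open>phat\<close> then satisfies
  \<open>S phat \<le> 6 * S p - inf S + 4 * c + 4 * R * \<epsilon>\<close> (\<open>l2_estimator_risk_le\<close>). Letting \<open>S p\<close> approach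
  \<open>inf S\<close> gives the factor 5.

  It remains to find \<open>c\<close>. The test functions lie in the unit ball of \<open>V\<close>. Point evaluations on \<open>V\<close> have norm
  at most \<open>R\<close>, so the squares of an orthonormal system of \<open>V\<close> sum up to at most \<open>R\<^sup>2\<close> at every point
  (\<open>sum_orthonormal_square_le\<close>). Hence the supremum over the test functions of the centred sums has
  expectation at most \<open>R * sqrt n\<close> (\<open>expectation_Max_deviation_le\<close>), and McDiarmid's inequality
  (\<open>mcdiarmid_inequality\<close>) adds \<open>R * sqrt (2 * n * \<xi>)\<close> with probability \<open>1 - exp (- \<xi>)\<close>. The model being
  countable, it suffices to treat finitely many test functions at a time; these span a
  finite-dimensional space, where Gram-Schmidt replaces a general theory of reproducing kernels.
\<close>

section \<open>McDiarmid's inequality\<close>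

text \<open>
  Integrating out one coordinate \<open>i\<close> replaces \<open>g\<close> by a function \<open>h\<close> of the remaining coordinates.
  For fixed remaining coordinates, \<open>g - h\<close> is centred with values in an interval of length
  \<open>c i\<close>, so Hoeffding's lemma bounds its exponential moment; \<open>h\<close> inherits the bounded
  differences of \<open>g\<close> in the other coordinates, and the induction continues with \<open>h\<close>.
  This is the martingale argument for McDiarmid's inequality with Fubini's theorem in place of
  conditional expectations.
\<close>

lemma (in product_prob_space) nn_integral_exp_bounded_differences:
  fixes g :: "('i \<Rightarrow> 'a) \<Rightarrow> real"
  assumes "finite J" and "g \<in> borel_measurable (PiM J M)"
    and "\<And>x. x \<in> space (PiM J M) \<Longrightarrow> \<bar>g x\<bar> \<le> B"
    and "\<And>i x y. i \<in> J \<Longrightarrow> x \<in> space (PiM J M) \<Longrightarrow> y \<in> space (M i) \<Longrightarrow> \<bar>g (x(i := y)) - g x\<bar> \<le> c i"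
    and "l > 0"
  shows "(\<integral>\<^sup>+x. ennreal (exp (l * (g x - (\<integral>z. g z \<partial>PiM J M)))) \<partial>PiM J M)
         \<le> ennreal (exp (l\<^sup>2 * (\<Sum>i\<in>J. (c i)\<^sup>2) / 8))"
  using assms(1-4)
proof (induction J arbitrary: g rule: finite_induct)
  case empty
  have "(\<integral>z. g z \<partial>PiM {} M) = g (\<lambda>_. undefined)"
    by (simp add: PiM_empty lebesgue_integral_count_space_finite)
  then show ?case
    by (simp add: nn_integral_empty)
next
  case (insert i J)
  note [measurable] = insert.prems(1)
  interpret iJ: prob_space "PiM (insert i J) M" by (intro prob_space_PiM prob_space)
  have upd: "x(i := y) \<in> space (PiM (insert i J) M)"
    if "x \<in> space (PiM J M)" "y \<in> space (M i)" for x y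
    using that by (auto simp: space_PiM PiE_def extensional_def)
  have gy[measurable]: "(\<lambda>y. g (x(i := y))) \<in> borel_measurable (M i)" if "x \<in> space (PiM J M)" for x
    using measurable_comp[OF measurable_component_update[OF that insert.hyps(2)] insert.prems(1)]
    by (simp add: comp_def)
  have int_g: "integrable (M i) (\<lambda>y. g (x(i := y)))" if "x \<in> space (PiM J M)" for x
    using that upd insert.prems(2)
    by (intro M.integrable_const_bound[where B = B] gy) (auto intro!: AE_I2)
  define h where "h x = (\<integral>y. g (x(i := y)) \<partial>M i)" for x
  have upd_meas[measurable]: "(\<lambda>(x, y). g (x(i := y))) \<in> borel_measurable (PiM J M \<Otimes>\<^sub>M M i)"
    using measurable_comp[OF measurable_add_dim insert.prems(1)]
    by (simp add: comp_def case_prod_beta')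
  have h_meas[measurable]: "h \<in> borel_measurable (PiM J M)"
    unfolding h_def by measurable
  have h_bound: "\<bar>h x\<bar> \<le> B" if x: "x \<in> space (PiM J M)" for x
  proof -
    have "\<bar>h x\<bar> \<le> (\<integral>y. \<bar>g (x(i := y))\<bar> \<partial>M i)"
      unfolding h_def by (rule integral_abs_bound)
    also have "\<dots> \<le> (\<integral>y. B \<partial>M i)"
      using int_g[OF x] upd[OF x] insert.prems(2) by (intro Bochner_Integration.integral_mono) auto
    finally show ?thesis by (simp add: M.prob_space)
  qed
  have h_diff: "\<bar>h (x(j := z)) - h x\<bar> \<le> c j"
    if j: "j \<in> J" and x: "x \<in> space (PiM J M)" and z: "z \<in> space (M j)" for j x z
  proof -
    have x': "x(j := z) \<in> space (PiM J M)"
      using j x z by (auto simp: space_PiM PiE_def extensional_def)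
    have "h (x(j := z)) - h x = (\<integral>y. g (x(j := z, i := y)) - g (x(i := y)) \<partial>M i)"
      unfolding h_def using int_g[OF x] int_g[OF x'] by simp
    also have "\<bar>\<dots>\<bar> \<le> (\<integral>y. \<bar>g (x(j := z, i := y)) - g (x(i := y))\<bar> \<partial>M i)"
      by (rule integral_abs_bound)
    also have "\<dots> \<le> (\<integral>y. c j \<partial>M i)"
    proof (rule Bochner_Integration.integral_mono)
      fix y assume "y \<in> space (M i)"
      moreover have "x(j := z, i := y) = x(i := y, j := z)"
        using j insert.hyps by (intro fun_upd_twist) auto
      ultimately show "\<bar>g (x(j := z, i := y)) - g (x(i := y))\<bar> \<le> c j"
        using insert.prems(3)[of j "x(i := y)" z] j z upd[OF x, of y] by (simp del: fun_upd_apply)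
    qed (use int_g[OF x] int_g[OF x'] in auto)
    finally show ?thesis by (simp add: M.prob_space)
  qed
  have int_gJ: "integrable (PiM (insert i J) M) g"
    using insert.prems by (intro iJ.integrable_const_bound[where B = B]) auto
  have E: "(\<integral>z. g z \<partial>PiM (insert i J) M) = (\<integral>x. h x \<partial>PiM J M)"
    unfolding h_def using insert.hyps int_gJ by (rule product_integral_insert)
  define m where "m = (\<integral>x. h x \<partial>PiM J M)"
  have inner: "(\<integral>\<^sup>+y. ennreal (exp (l * (g (x(i := y)) - m))) \<partial>M i)
      \<le> ennreal (exp (l\<^sup>2 * (c i)\<^sup>2 / 8)) * ennreal (exp (l * (h x - m)))"
    if x: "x \<in> space (PiM J M)" for x
  proof -
    \<comment> \<open>Hoeffding's lemma needs an explicit interval: the values of \<open>g\<close> along coordinate \<open>i\<close> differ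
      pairwise by at most \<open>c i\<close>, so they lie within \<open>c i\<close> of their infimum.\<close>
    define a where "a = (INF y\<in>space (M i). g (x(i := y)))"
    have bdd: "bdd_below ((\<lambda>y. g (x(i := y))) ` space (M i))"
      using insert.prems(2) upd[OF x] by (intro bdd_belowI2[where m = "-B"]) (smt (verit))
    have a_le: "a \<le> g (x(i := y))" if "y \<in> space (M i)" for y
      unfolding a_def using bdd that by (rule cINF_lower)
    have le_a: "g (x(i := y)) \<le> a + c i" if y: "y \<in> space (M i)" for y
    proof -
      have "g (x(i := y)) - c i \<le> a"
        unfolding a_def
      proof (rule cINF_greatest)
        fix z assume z: "z \<in> space (M i)"
        show "g (x(i := y)) - c i \<le> g (x(i := z))"
          using insert.prems(3)[of i "x(i := z)" y] upd[OF x, of z] y z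
            by (simp del: fun_upd_apply)
      qed (use y in auto)
      then show ?thesis by simp
    qed
    interpret interval_bounded_random_variable "M i" "\<lambda>y. g (x(i := y))" a "a + c i"
      by unfold_locales (use a_le le_a x in \<open>auto intro!: AE_I2\<close>)
    have "(\<integral>\<^sup>+y. ennreal (exp (l * (g (x(i := y)) - m))) \<partial>M i)
        = (\<integral>\<^sup>+y. ennreal (exp (l * (h x - m))) * ennreal (exp (l * (g (x(i := y)) - h x))) \<partial>M i)"
      by (intro nn_integral_cong) (simp add: ennreal_mult[symmetric] exp_add[symmetric] algebra_simps)
    also have "\<dots> = ennreal (exp (l * (h x - m))) * (\<integral>\<^sup>+y. ennreal (exp (l * (g (x(i := y)) - h x))) \<partial>M i)"
      using x by (intro nn_integral_cmult) measurable
    also have "\<dots> \<le> ennreal (exp (l * (h x - m))) * ennreal (exp (l\<^sup>2 * (c i)\<^sup>2 / 8))"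
      using Hoeffdings_lemma_nn_integral[OF \<open>l > 0\<close>] by (intro mult_left_mono) (simp_all add: h_def)
    finally show ?thesis by (simp add: mult.commute)
  qed
  have "(\<integral>\<^sup>+x. ennreal (exp (l * (g x - m))) \<partial>PiM (insert i J) M)
      = (\<integral>\<^sup>+x. (\<integral>\<^sup>+y. ennreal (exp (l * (g (x(i := y)) - m))) \<partial>M i) \<partial>PiM J M)"
    using insert.hyps by (intro product_nn_integral_insert) measurable
  also have "\<dots> \<le> (\<integral>\<^sup>+x. ennreal (exp (l\<^sup>2 * (c i)\<^sup>2 / 8)) * ennreal (exp (l * (h x - m))) \<partial>PiM J M)"
    by (intro nn_integral_mono inner)
  also have "\<dots> = ennreal (exp (l\<^sup>2 * (c i)\<^sup>2 / 8)) * (\<integral>\<^sup>+x. ennreal (exp (l * (h x - m))) \<partial>PiM J M)"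
    by (intro nn_integral_cmult) measurable
  also have "\<dots> \<le> ennreal (exp (l\<^sup>2 * (c i)\<^sup>2 / 8)) * ennreal (exp (l\<^sup>2 * (\<Sum>i\<in>J. (c i)\<^sup>2) / 8))"
    unfolding m_def by (intro mult_left_mono insert.IH h_meas h_bound h_diff) auto
  also have "\<dots> = ennreal (exp (l\<^sup>2 * (\<Sum>i\<in>insert i J. (c i)\<^sup>2) / 8))"
    using insert.hyps by (simp add: ennreal_mult[symmetric] exp_add[symmetric] algebra_simps add_divide_distrib)
  finally show ?case by (simp add: E m_def)
qed

text \<open>
  Chernoff's bound applied to the exponential moment above. Independence says that the joint law of
  the \<open>X i\<close> is the product of their laws, which reduces the claim to functions on a product space.
\<close>

theorem (in prob_space) mcdiarmid_inequality:
  fixes g :: "('i \<Rightarrow> 'b) \<Rightarrow> real" and X :: "'i \<Rightarrow> 'a \<Rightarrow> 'b"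
  assumes I: "finite I" "I \<noteq> {}" and indep: "indep_vars (\<lambda>_. N) X I"
    and g[measurable]: "g \<in> borel_measurable (PiM I (\<lambda>_. N))"
    and bounded: "\<And>x. x \<in> space (PiM I (\<lambda>_. N)) \<Longrightarrow> \<bar>g x\<bar> \<le> B"
    and diff: "\<And>i x y. i \<in> I \<Longrightarrow> x \<in> space (PiM I (\<lambda>_. N)) \<Longrightarrow> y \<in> space N \<Longrightarrow>
      \<bar>g (x(i := y)) - g x\<bar> \<le> c i"
    and t: "t > 0" and d: "(\<Sum>i\<in>I. (c i)\<^sup>2) > 0"
  defines "Y \<equiv> \<lambda>\<omega>. g (\<lambda>i\<in>I. X i \<omega>)"
  shows "prob {\<omega> \<in> space M. Y \<omega> \<ge> expectation Y + t} \<le> exp (- 2 * t\<^sup>2 / (\<Sum>i\<in>I. (c i)\<^sup>2))"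
proof -
  define d where "d = (\<Sum>i\<in>I. (c i)\<^sup>2)"
  \<comment> \<open>the minimiser of the exponent \<open>- l * t + l\<^sup>2 * d / 8\<close>\<close>
  define l where "l = 4 * t / d"
  have "d > 0" and l: "l > 0" using t d by (simp_all add: d_def l_def)
  have rv[measurable]: "X i \<in> measurable M N" if "i \<in> I" for i
    using indep that by (simp add: indep_vars_def)
  obtain k where k: "k \<in> I" using I by auto
  \<comment> \<open>The product locale asks for a probability measure at every index; outside \<open>I\<close>, where
    \<open>X i\<close> need not be measurable, the law of one fixed \<open>X k\<close> fills in.\<close>
  define D where "D i = distr M N (X (if i \<in> I then i else k))" for i
  have prob_D: "prob_space (D i)" for i
    unfolding D_def using k by (intro prob_space_distr rv) auto
  interpret D: product_prob_space D I
    by (intro product_prob_spaceI prob_D)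
  have sets_D[measurable_cong]: "sets (D i) = sets N" for i by (simp add: D_def)
  have sets_P: "sets (PiM I D) = sets (PiM I (\<lambda>_. N))"
    by (intro sets_PiM_cong) (auto simp: sets_D)
  have space_P: "space (PiM I D) = space (PiM I (\<lambda>_. N))"
    by (rule sets_eq_imp_space_eq[OF sets_P])
  have gD: "g \<in> borel_measurable (PiM I D)"
    using g by (simp add: measurable_cong_sets[OF sets_P refl])
  have distr: "distr M (PiM I (\<lambda>_. N)) (\<lambda>\<omega>. \<lambda>i\<in>I. X i \<omega>) = PiM I D"
    using indep_vars_iff_distr_eq_PiM'[OF I(2), of X "\<lambda>_. N"] rv indep
    by (auto simp: D_def intro!: PiM_cong)
  have XI[measurable]: "(\<lambda>\<omega>. \<lambda>i\<in>I. X i \<omega>) \<in> measurable M (PiM I (\<lambda>_. N))"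
    by measurable
  have Y[measurable]: "Y \<in> borel_measurable M"
    unfolding Y_def by measurable
  have E: "expectation Y = (\<integral>x. g x \<partial>PiM I D)"
    unfolding distr[symmetric] Y_def by (simp add: integral_distr)
  have "(\<integral>\<^sup>+\<omega>. ennreal (exp (l * (Y \<omega> - expectation Y))) \<partial>M)
      = (\<integral>\<^sup>+x. ennreal (exp (l * (g x - expectation Y))) \<partial>PiM I D)"
    unfolding distr[symmetric] Y_def by (simp add: nn_integral_distr)
  also have "\<dots> \<le> ennreal (exp (l\<^sup>2 * (\<Sum>i\<in>I. (c i)\<^sup>2) / 8))"
    unfolding E using bounded diff
    by (intro D.nn_integral_exp_bounded_differences[where B = B] I gD l) 
       (auto simp: space_P sets_eq_imp_space_eq[OF sets_D])
  finally have mgf: "(\<integral>\<^sup>+\<omega>. ennreal (exp (l * (Y \<omega> - expectation Y))) \<partial>M)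
      \<le> ennreal (exp (l\<^sup>2 * d / 8))" by (simp add: d_def)
  have "ennreal (prob {\<omega> \<in> space M. Y \<omega> \<ge> expectation Y + t})
      = emeasure M {\<omega> \<in> space M. Y \<omega> - expectation Y \<ge> t}"
    by (simp add: emeasure_eq_measure algebra_simps)
  also have "\<dots> \<le> ennreal (exp (- l * t)) * (\<integral>\<^sup>+\<omega>\<in>space M. ennreal (exp (l * (Y \<omega> - expectation Y))) \<partial>M)"
    by (intro Chernoff_ineq_nn_integral_ge l) auto
  also have "(\<integral>\<^sup>+\<omega>\<in>space M. ennreal (exp (l * (Y \<omega> - expectation Y))) \<partial>M)
      = (\<integral>\<^sup>+\<omega>. ennreal (exp (l * (Y \<omega> - expectation Y))) \<partial>M)"
    by (intro nn_integral_cong) auto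
  also have "ennreal (exp (- l * t)) * \<dots> \<le> ennreal (exp (- l * t)) * ennreal (exp (l\<^sup>2 * d / 8))"
    by (intro mult_left_mono mgf) auto
  also have "\<dots> = ennreal (exp (- l * t + l\<^sup>2 * d / 8))"
    by (simp add: ennreal_mult[symmetric] exp_add[symmetric])
  also have "- l * t + l\<^sup>2 * d / 8 = - 2 * t\<^sup>2 / d"
    using \<open>d > 0\<close> by (simp add: l_def field_simps power2_eq_square)
  finally show ?thesis by (simp add: d_def)
qed

section \<open>The inner product of square integrable functions\<close>

lemma linear_subspace_iff:
  "linear_subspace V \<longleftrightarrow>
     (\<lambda>_. 0) \<in> V \<and> (\<forall>f\<in>V. \<forall>g\<in>V. (\<lambda>x. f x + g x) \<in> V) \<and> (\<forall>c. \<forall>f\<in>V. (\<lambda>x. c * f x) \<in> V)"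
proof -
  have "module (\<lambda>(c::real) f (x::'a). c * f x)"
    by unfold_locales (auto simp: fun_eq_iff algebra_simps)
  from module.subspace_def[OF this] show ?thesis
    by (auto simp: linear_subspace_def zero_fun_def plus_fun_def)
qed

definition l2_inner :: "'a measure \<Rightarrow> ('a \<Rightarrow> real) \<Rightarrow> ('a \<Rightarrow> real) \<Rightarrow> real" where
  "l2_inner \<mu> f g = (\<integral>x. f x * g x \<partial>\<mu>)"

lemma l2_inner_commute: "l2_inner \<mu> f g = l2_inner \<mu> g f"
  by (simp add: l2_inner_def mult.commute)

lemma l2_inner_nonneg: "0 \<le> l2_inner \<mu> f f"
  by (simp add: l2_inner_def)

lemma Lnorm_2: "Lnorm \<mu> 2 f = sqrt (l2_inner \<mu> f f)"
  by (simp add: Lnorm_def l2_inner_def sqrt_def power2_eq_square)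

lemma Lnorm_2_nonneg: "0 \<le> Lnorm \<mu> 2 f"
  by (simp add: Lnorm_2 l2_inner_nonneg)

lemma Lnorm_2_square: "(Lnorm \<mu> 2 f)\<^sup>2 = l2_inner \<mu> f f"
  by (simp add: Lnorm_2 l2_inner_nonneg)

lemma Lspace_2_iff: "f \<in> Lspace \<mu> 2 \<longleftrightarrow> f \<in> borel_measurable \<mu> \<and> integrable \<mu> (\<lambda>x. (f x)\<^sup>2)"
  by (simp add: Lspace_def)

lemma integrable_mult_Lspace_2:
  assumes "f \<in> Lspace \<mu> 2" "g \<in> Lspace \<mu> 2"
  shows "integrable \<mu> (\<lambda>x. f x * g x)"
proof (rule Bochner_Integration.integrable_bound)
  show "integrable \<mu> (\<lambda>x. (f x)\<^sup>2 + (g x)\<^sup>2)"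
    using assms by (simp add: Lspace_2_iff)
  show "(\<lambda>x. f x * g x) \<in> borel_measurable \<mu>"
    using assms by (auto simp: Lspace_2_iff)
  have "\<bar>a * b\<bar> \<le> a\<^sup>2 + b\<^sup>2" for a b :: real
    using sum_squares_bound[of "\<bar>a\<bar>" "\<bar>b\<bar>"] abs_ge_zero[of "a * b"]
    unfolding abs_mult power2_abs by linarith
  then show "AE x in \<mu>. norm (f x * g x) \<le> norm ((f x)\<^sup>2 + (g x)\<^sup>2)"
    by simp
qed

lemma Lspace_2_add: "(\<lambda>x. f x + g x) \<in> Lspace \<mu> 2"
  if "f \<in> Lspace \<mu> 2" "g \<in> Lspace \<mu> 2"
  using that integrable_mult_Lspace_2[OF that] by (auto simp: Lspace_2_iff power2_sum mult.assoc)

lemma Lspace_2_cmult: "(\<lambda>x. c * f x) \<in> Lspace \<mu> 2" if "f \<in> Lspace \<mu> 2"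
  using that by (auto simp: Lspace_2_iff power_mult_distrib)

lemma Lspace_2_diff: "(\<lambda>x. f x - g x) \<in> Lspace \<mu> 2"
  if "f \<in> Lspace \<mu> 2" "g \<in> Lspace \<mu> 2"
  using Lspace_2_add[OF that(1) Lspace_2_cmult[OF that(2), of "-1"]] by simp

lemma l2_inner_add_left:
  "l2_inner \<mu> (\<lambda>x. f x + g x) h = l2_inner \<mu> f h + l2_inner \<mu> g h"
  if "f \<in> Lspace \<mu> 2" "g \<in> Lspace \<mu> 2" "h \<in> Lspace \<mu> 2"
  using that by (simp add: l2_inner_def distrib_right integrable_mult_Lspace_2)

lemma l2_inner_diff_left:
  "l2_inner \<mu> (\<lambda>x. f x - g x) h = l2_inner \<mu> f h - l2_inner \<mu> g h"
  if "f \<in> Lspace \<mu> 2" "g \<in> Lspace \<mu> 2" "h \<in> Lspace \<mu> 2"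
  using that by (simp add: l2_inner_def left_diff_distrib integrable_mult_Lspace_2)

lemma l2_inner_diff_right:
  "l2_inner \<mu> h (\<lambda>x. f x - g x) = l2_inner \<mu> h f - l2_inner \<mu> h g"
  if "f \<in> Lspace \<mu> 2" "g \<in> Lspace \<mu> 2" "h \<in> Lspace \<mu> 2"
  using l2_inner_diff_left[OF that] by (simp add: l2_inner_commute[of \<mu> h])

lemma l2_inner_cmult_left: "l2_inner \<mu> (\<lambda>x. c * f x) h = c * l2_inner \<mu> f h"
  by (simp add: l2_inner_def mult.assoc)

lemma l2_inner_cmult_right: "l2_inner \<mu> h (\<lambda>x. c * f x) = c * l2_inner \<mu> h f"
  using l2_inner_cmult_left[of \<mu> c f h] by (simp add: l2_inner_commute[of \<mu> h])

lemma l2_inner_add_right: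
  "l2_inner \<mu> h (\<lambda>x. f x + g x) = l2_inner \<mu> h f + l2_inner \<mu> h g"
  if "f \<in> Lspace \<mu> 2" "g \<in> Lspace \<mu> 2" "h \<in> Lspace \<mu> 2"
  using l2_inner_add_left[OF that] by (simp add: l2_inner_commute[of \<mu> h])

lemma l2_inner_sum_left:
  "l2_inner \<mu> (\<lambda>x. \<Sum>\<phi>\<in>\<Phi>. a \<phi> * \<phi> x) h = (\<Sum>\<phi>\<in>\<Phi>. a \<phi> * l2_inner \<mu> \<phi> h)"
  if "\<Phi> \<subseteq> Lspace \<mu> 2" "h \<in> Lspace \<mu> 2"
proof -
  have "l2_inner \<mu> (\<lambda>x. \<Sum>\<phi>\<in>\<Phi>. a \<phi> * \<phi> x) h = (\<integral>x. (\<Sum>\<phi>\<in>\<Phi>. a \<phi> * (\<phi> x * h x)) \<partial>\<mu>)"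
    by (simp add: l2_inner_def sum_distrib_right mult.assoc)
  also have "\<dots> = (\<Sum>\<phi>\<in>\<Phi>. \<integral>x. a \<phi> * (\<phi> x * h x) \<partial>\<mu>)"
    using that by (intro Bochner_Integration.integral_sum integrable_mult_right integrable_mult_Lspace_2) auto
  finally show ?thesis by (simp add: l2_inner_def)
qed

lemma l2_inner_cong_left:
  "(\<And>x. x \<in> space \<mu> \<Longrightarrow> f x = g x) \<Longrightarrow> l2_inner \<mu> f h = l2_inner \<mu> g h"
  unfolding l2_inner_def by (intro Bochner_Integration.integral_cong) auto

text \<open>
  Almost everywhere vanishing functions make the form only semidefinite, so the discriminant argument
  treats \<open>l2_inner \<mu> g g = 0\<close> separately: there a linear function of \<open>t\<close> is bounded below.
\<close>

lemma l2_cauchy_schwarz: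
  assumes f: "f \<in> Lspace \<mu> 2" and g: "g \<in> Lspace \<mu> 2"
  shows "l2_inner \<mu> f g \<le> Lnorm \<mu> 2 f * Lnorm \<mu> 2 g"
proof -
  define a b c where "a = l2_inner \<mu> f f" and "b = l2_inner \<mu> f g" and "c = l2_inner \<mu> g g"
  have quad: "0 \<le> a - 2 * t * b + t\<^sup>2 * c" for t
  proof -
    have tg: "(\<lambda>x. t * g x) \<in> Lspace \<mu> 2" by (rule Lspace_2_cmult[OF g])
    have "l2_inner \<mu> (\<lambda>x. f x - t * g x) (\<lambda>x. f x - t * g x) = a - 2 * t * b + t\<^sup>2 * c"
      using f g tg Lspace_2_diff[OF f tg] l2_inner_commute[of \<mu> g f]
      by (simp add: l2_inner_diff_left l2_inner_diff_right l2_inner_cmult_left l2_inner_cmult_right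
          a_def b_def c_def power2_eq_square algebra_simps)
    with l2_inner_nonneg show ?thesis by metis
  qed
  have "c \<ge> 0" by (simp add: c_def l2_inner_nonneg)
  have "b\<^sup>2 \<le> a * c"
  proof (cases "c = 0")
    case True
    have "b = 0"
    proof (rule ccontr)
      assume "b \<noteq> 0"
      with quad[of "(a + 1) / (2 * b)"] True show False by (simp add: field_simps)
    qed
    with True show ?thesis by simp
  next
    case False
    with \<open>c \<ge> 0\<close> quad[of "b / c"] show ?thesis by (simp add: field_simps power2_eq_square)
  qed
  then have "\<bar>b\<bar> \<le> sqrt (a * c)" using real_sqrt_le_mono by fastforce
  then show ?thesis by (simp add: Lnorm_2 a_def b_def c_def real_sqrt_mult)
qed

lemma Lnorm_2_triangle:
  assumes f: "f \<in> Lspace \<mu> 2" and g: "g \<in> Lspace \<mu> 2"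
  shows "Lnorm \<mu> 2 (\<lambda>x. f x + g x) \<le> Lnorm \<mu> 2 f + Lnorm \<mu> 2 g"
proof (rule power2_le_imp_le)
  have "(Lnorm \<mu> 2 (\<lambda>x. f x + g x))\<^sup>2 = l2_inner \<mu> f f + 2 * l2_inner \<mu> f g + l2_inner \<mu> g g"
    unfolding Lnorm_2_square using f g Lspace_2_add[OF f g]
    by (simp add: l2_inner_add_left l2_inner_add_right l2_inner_commute[of \<mu> g f])
  also have "\<dots> \<le> (Lnorm \<mu> 2 f + Lnorm \<mu> 2 g)\<^sup>2"
    using l2_cauchy_schwarz[OF f g] by (simp add: power2_sum Lnorm_2_square)
  finally show "(Lnorm \<mu> 2 (\<lambda>x. f x + g x))\<^sup>2 \<le> (Lnorm \<mu> 2 f + Lnorm \<mu> 2 g)\<^sup>2" .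
qed (simp add: Lnorm_2_nonneg)

lemma Lnorm_2_cmult: "Lnorm \<mu> 2 (\<lambda>x. c * f x) = \<bar>c\<bar> * Lnorm \<mu> 2 f"
proof -
  have "l2_inner \<mu> (\<lambda>x. c * f x) (\<lambda>x. c * f x) = c\<^sup>2 * l2_inner \<mu> f f"
    by (simp add: l2_inner_cmult_left l2_inner_cmult_right power2_eq_square)
  then show ?thesis by (simp add: Lnorm_2 real_sqrt_mult)
qed

lemma Lnorm_2_diff_commute: "Lnorm \<mu> 2 (\<lambda>x. f x - g x) = Lnorm \<mu> 2 (\<lambda>x. g x - f x)"
  using Lnorm_2_cmult[of \<mu> "-1" "\<lambda>x. f x - g x"] by simp

section \<open>Subspaces on which point evaluations are bounded\<close>

text \<open>
  The bound of the supremum norm by the \<open>L2\<close> norm says that all point evaluations on \<open>V\<close> have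
  operator norm at most \<open>R\<close>: \<open>V\<close> behaves as a space with a reproducing kernel bounded by
  \<open>R\<^sup>2\<close> on the diagonal.
\<close>

locale bounded_l2_subspace =
  fixes \<mu> :: "'a measure" and V :: "('a \<Rightarrow> real) set" and R :: real
  assumes subspace: "linear_subspace V"
    and square_integrable: "V \<subseteq> Lspace \<mu> 2"
    and R_pos: "R > 0"
    and supnorm_le: "t \<in> V \<Longrightarrow> supnorm \<mu> t \<le> ereal (R * Lnorm \<mu> 2 t)"
begin

lemma add_mem: "f \<in> V \<Longrightarrow> g \<in> V \<Longrightarrow> (\<lambda>x. f x + g x) \<in> V"
  and cmult_mem: "f \<in> V \<Longrightarrow> (\<lambda>x. c * f x) \<in> V"
  and zero_mem: "(\<lambda>_. 0) \<in> V"
  using subspace by (auto simp: linear_subspace_iff)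

lemma diff_mem: "f \<in> V \<Longrightarrow> g \<in> V \<Longrightarrow> (\<lambda>x. f x - g x) \<in> V"
  using add_mem[OF _ cmult_mem[of g "-1"], of f] by simp

lemma sum_mem: "\<Phi> \<subseteq> V \<Longrightarrow> (\<lambda>x. \<Sum>\<phi>\<in>\<Phi>. a \<phi> * \<phi> x) \<in> V"
  by (induction \<Phi> rule: infinite_finite_induct) (auto intro: zero_mem add_mem cmult_mem)

lemma abs_le_Lnorm: "\<bar>t x\<bar> \<le> R * Lnorm \<mu> 2 t" if "t \<in> V" "x \<in> space \<mu>"
proof -
  have "ereal \<bar>t x\<bar> \<le> supnorm \<mu> t"
    unfolding supnorm_def using that by (intro SUP_upper)
  also note supnorm_le[OF that(1)]
  finally show ?thesis by simp
qed

text \<open>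
  Gram-Schmidt orthonormalisation. The expansion holds at every point and not merely almost
  everywhere, because an element of \<open>V\<close> of norm zero vanishes on the whole space by
  \<open>abs_le_Lnorm\<close>.
\<close>

lemma orthonormal_expansion:
  assumes "finite F" and "F \<subseteq> V"
  obtains \<Phi> where "finite \<Phi>" and "\<Phi> \<subseteq> V"
    and "\<And>\<phi> \<psi>. \<phi> \<in> \<Phi> \<Longrightarrow> \<psi> \<in> \<Phi> \<Longrightarrow> l2_inner \<mu> \<phi> \<psi> = (if \<phi> = \<psi> then 1 else 0)"
    and "\<And>f x. f \<in> F \<Longrightarrow> x \<in> space \<mu> \<Longrightarrow> f x = (\<Sum>\<phi>\<in>\<Phi>. l2_inner \<mu> f \<phi> * \<phi> x)"
proof -
  have "\<exists>\<Phi>. finite \<Phi> \<and> \<Phi> \<subseteq> V \<and>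
    (\<forall>\<phi>\<in>\<Phi>. \<forall>\<psi>\<in>\<Phi>. l2_inner \<mu> \<phi> \<psi> = (if \<phi> = \<psi> then 1 else 0)) \<and>
    (\<forall>f\<in>F. \<forall>x\<in>space \<mu>. f x = (\<Sum>\<phi>\<in>\<Phi>. l2_inner \<mu> f \<phi> * \<phi> x))"
    using assms
  proof (induction F rule: finite_induct)
    case empty
    show ?case by (intro exI[of _ "{}"]) auto
  next
    case (insert f F)
    from insert.prems have "F \<subseteq> V" by simp
    from insert.IH[OF this] obtain \<Phi> where fin: "finite \<Phi>" and \<Phi>V: "\<Phi> \<subseteq> V"
      and on: "\<forall>\<phi>\<in>\<Phi>. \<forall>\<psi>\<in>\<Phi>. l2_inner \<mu> \<phi> \<psi> = (if \<phi> = \<psi> then 1 else 0)"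
      and ex: "\<forall>f\<in>F. \<forall>x\<in>space \<mu>. f x = (\<Sum>\<phi>\<in>\<Phi>. l2_inner \<mu> f \<phi> * \<phi> x)"
      by (elim exE conjE) (rule that)
    have \<Phi>L: "\<Phi> \<subseteq> Lspace \<mu> 2" and fV: "f \<in> V" and fL: "f \<in> Lspace \<mu> 2"
      using \<Phi>V insert.prems square_integrable by auto
    \<comment> \<open>\<open>s\<close> is the orthogonal projection of \<open>f\<close> on the span of \<open>\<Phi>\<close>. Either \<open>f = s\<close>, or the
      normalised residual extends the orthonormal system.\<close>
    define s where "s x = (\<Sum>\<phi>\<in>\<Phi>. l2_inner \<mu> f \<phi> * \<phi> x)" for x
    define r where "r x = f x - s x" for x
    have sV: "s \<in> V" unfolding s_def[abs_def] by (rule sum_mem[OF \<Phi>V])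
    then have rV: "r \<in> V" unfolding r_def[abs_def] by (intro diff_mem fV)
    have sL: "s \<in> Lspace \<mu> 2" and rL: "r \<in> Lspace \<mu> 2" using sV rV square_integrable by auto
    have orth: "l2_inner \<mu> r \<phi> = 0" if "\<phi> \<in> \<Phi>" for \<phi>
    proof -
      have "l2_inner \<mu> s \<phi> = (\<Sum>\<psi>\<in>\<Phi>. l2_inner \<mu> f \<psi> * l2_inner \<mu> \<psi> \<phi>)"
        unfolding s_def[abs_def] using \<Phi>L that by (intro l2_inner_sum_left) auto
      also have "\<dots> = (\<Sum>\<psi>\<in>\<Phi>. if \<psi> = \<phi> then l2_inner \<mu> f \<phi> else 0)"
        using that by (intro sum.cong) (auto simp: on)
      finally show ?thesis
        unfolding r_def[abs_def] using fin that fL sL \<Phi>L by (subst l2_inner_diff_left) auto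
    qed
    show ?case
    proof (cases "Lnorm \<mu> 2 r = 0")
      case True
      have "f x = s x" if "x \<in> space \<mu>" for x
        using abs_le_Lnorm[OF rV that] True by (simp add: r_def)
      with fin \<Phi>V on ex show ?thesis by (intro exI[of _ \<Phi>]) (auto simp: s_def)
    next
      case False
      define k where "k = 1 / Lnorm \<mu> 2 r"
      define \<psi> where "\<psi> x = k * r x" for x
      have \<psi>V: "\<psi> \<in> V" unfolding \<psi>_def[abs_def] by (rule cmult_mem[OF rV])
      then have \<psi>L: "\<psi> \<in> Lspace \<mu> 2" using square_integrable by auto
      have \<psi>_inner: "l2_inner \<mu> h \<psi> = k * l2_inner \<mu> h r" for h
        unfolding \<psi>_def[abs_def] by (rule l2_inner_cmult_right)
      have \<psi>\<psi>: "l2_inner \<mu> \<psi> \<psi> = 1"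
        using \<psi>_inner[of \<psi>] \<psi>_inner[of r] False
        by (simp add: l2_inner_commute[of \<mu> \<psi> r] k_def Lnorm_2_square[symmetric] power2_eq_square)
      have \<psi>_orth: "l2_inner \<mu> \<phi> \<psi> = 0" "l2_inner \<mu> \<psi> \<phi> = 0" if "\<phi> \<in> \<Phi>" for \<phi>
        using orth[OF that] \<psi>_inner[of \<phi>] by (simp_all add: l2_inner_commute)
      have "\<psi> \<notin> \<Phi>" using \<psi>\<psi> \<psi>_orth(1)[of \<psi>] by auto
      have span: "l2_inner \<mu> h \<psi> = 0"
        if "\<And>x. x \<in> space \<mu> \<Longrightarrow> h x = (\<Sum>\<phi>\<in>\<Phi>. a \<phi> * \<phi> x)" for h a
      proof -
        have "l2_inner \<mu> h \<psi> = l2_inner \<mu> (\<lambda>x. \<Sum>\<phi>\<in>\<Phi>. a \<phi> * \<phi> x) \<psi>"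
          by (rule l2_inner_cong_left) (rule that)
        also have "\<dots> = 0" using \<Phi>L \<psi>L by (simp add: l2_inner_sum_left \<psi>_orth)
        finally show ?thesis .
      qed
      have "l2_inner \<mu> f \<psi> = l2_inner \<mu> (\<lambda>x. r x + s x) \<psi>"
        by (simp add: r_def)
      also have "\<dots> = l2_inner \<mu> r \<psi>"
        using rL sL \<psi>L span[of s "l2_inner \<mu> f"] by (simp add: l2_inner_add_left s_def[symmetric])
      also have "\<dots> = Lnorm \<mu> 2 r"
        using \<psi>_inner[of r] False by (simp add: k_def Lnorm_2_square[symmetric] power2_eq_square)
      finally have f\<psi>: "l2_inner \<mu> f \<psi> * \<psi> x = r x" for x
        using False by (simp add: \<psi>_def k_def)
      show ?thesis
      proof (intro exI[of _ "insert \<psi> \<Phi>"] conjI ballI)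
        fix g x assume g: "g \<in> insert f F" and x: "x \<in> space \<mu>"
        show "g x = (\<Sum>\<phi>\<in>insert \<psi> \<Phi>. l2_inner \<mu> g \<phi> * \<phi> x)"
        proof (cases "g = f")
          case True
          then show ?thesis using fin \<open>\<psi> \<notin> \<Phi>\<close> f\<psi>[of x] by (simp add: r_def s_def)
        next
          case False
          with g have "g \<in> F" by auto
          with ex have expand: "g x = (\<Sum>\<phi>\<in>\<Phi>. l2_inner \<mu> g \<phi> * \<phi> x)" if "x \<in> space \<mu>" for x
            using that by blast
          have "l2_inner \<mu> g \<psi> = 0" by (rule span[OF expand])
          then show ?thesis
            using fin \<open>\<psi> \<notin> \<Phi>\<close> by (subst expand[OF x]) simp
        qed
      qed (use fin \<Phi>V \<psi>V on \<psi>\<psi> \<psi>_orth \<open>\<psi> \<notin> \<Phi>\<close> in auto)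
    qed
  qed
  then obtain \<Phi> where "finite \<Phi>" "\<Phi> \<subseteq> V"
    and on: "\<forall>\<phi>\<in>\<Phi>. \<forall>\<psi>\<in>\<Phi>. l2_inner \<mu> \<phi> \<psi> = (if \<phi> = \<psi> then 1 else 0)"
    and ex: "\<forall>f\<in>F. \<forall>x\<in>space \<mu>. f x = (\<Sum>\<phi>\<in>\<Phi>. l2_inner \<mu> f \<phi> * \<phi> x)"
    by (elim exE conjE) (rule that)
  then show thesis by (intro that[of \<Phi>] on[rule_format] ex[rule_format])
qed

text \<open>
  Evaluate at \<open>x\<close> the function \<open>t = (\<Sum>\<phi>\<in>\<Phi>. \<phi> x * \<phi>)\<close>, the reproducing kernel at \<open>x\<close> of the span of
  \<open>\<Phi>\<close>: both \<open>t x\<close> and the square of its norm equal the sum \<open>s\<close> on the left, so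
  \<open>s \<le> R * sqrt s\<close>.
\<close>

lemma sum_orthonormal_square_le:
  assumes "finite \<Phi>" and "\<Phi> \<subseteq> V"
    and on: "\<And>\<phi> \<psi>. \<phi> \<in> \<Phi> \<Longrightarrow> \<psi> \<in> \<Phi> \<Longrightarrow> l2_inner \<mu> \<phi> \<psi> = (if \<phi> = \<psi> then 1 else 0)"
    and x: "x \<in> space \<mu>"
  shows "(\<Sum>\<phi>\<in>\<Phi>. (\<phi> x)\<^sup>2) \<le> R\<^sup>2"
proof -
  define s where "s = (\<Sum>\<phi>\<in>\<Phi>. (\<phi> x)\<^sup>2)"
  define t where "t y = (\<Sum>\<phi>\<in>\<Phi>. \<phi> x * \<phi> y)" for y
  have \<Phi>L: "\<Phi> \<subseteq> Lspace \<mu> 2" using assms(2) square_integrable by auto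
  have tV: "t \<in> V" unfolding t_def[abs_def] by (rule sum_mem[OF assms(2)])
  then have tL: "t \<in> Lspace \<mu> 2" using square_integrable by auto
  have t\<phi>: "l2_inner \<mu> t \<phi> = \<phi> x" if "\<phi> \<in> \<Phi>" for \<phi>
  proof -
    have "l2_inner \<mu> t \<phi> = (\<Sum>\<psi>\<in>\<Phi>. \<psi> x * l2_inner \<mu> \<psi> \<phi>)"
      unfolding t_def[abs_def] using \<Phi>L that by (intro l2_inner_sum_left) auto
    also have "\<dots> = (\<Sum>\<psi>\<in>\<Phi>. if \<psi> = \<phi> then \<phi> x else 0)"
      using that by (intro sum.cong) (auto simp: on)
    finally show ?thesis using assms(1) that by simp
  qed
  have "l2_inner \<mu> t t = (\<Sum>\<phi>\<in>\<Phi>. \<phi> x * l2_inner \<mu> \<phi> t)"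
    using l2_inner_sum_left[OF \<Phi>L tL, of "\<lambda>\<phi>. \<phi> x"] by (simp add: t_def[abs_def])
  also have "\<dots> = s"
    unfolding s_def by (intro sum.cong) (auto simp: l2_inner_commute[of \<mu> _ t] t\<phi> power2_eq_square)
  finally have norm_t: "Lnorm \<mu> 2 t = sqrt s" by (simp add: Lnorm_2)
  have "s \<ge> 0" by (simp add: s_def sum_nonneg)
  have "t x = s" by (simp add: t_def s_def power2_eq_square)
  with abs_le_Lnorm[OF tV x] norm_t have "s \<le> R * sqrt s" by simp
  then have "sqrt s * sqrt s \<le> R * sqrt s" using \<open>s \<ge> 0\<close> by simp
  then have "sqrt s \<le> R"
    unfolding mult_le_cancel_right using \<open>s \<ge> 0\<close> R_pos by (cases "s = 0") auto
  then show ?thesis using \<open>s \<ge> 0\<close> by (simp add: s_def[symmetric] real_le_lsqrt sqrt_le_D)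
qed

lemma sum_coefficients_square:
  assumes "\<Phi> \<subseteq> V" "f \<in> V" "\<And>x. x \<in> space \<mu> \<Longrightarrow> f x = (\<Sum>\<phi>\<in>\<Phi>. l2_inner \<mu> f \<phi> * \<phi> x)"
  shows "(\<Sum>\<phi>\<in>\<Phi>. (l2_inner \<mu> f \<phi>)\<^sup>2) = (Lnorm \<mu> 2 f)\<^sup>2"
proof -
  have "(Lnorm \<mu> 2 f)\<^sup>2 = l2_inner \<mu> (\<lambda>x. \<Sum>\<phi>\<in>\<Phi>. l2_inner \<mu> f \<phi> * \<phi> x) f"
    unfolding Lnorm_2_square by (intro l2_inner_cong_left assms(3))
  also have "\<dots> = (\<Sum>\<phi>\<in>\<Phi>. l2_inner \<mu> f \<phi> * l2_inner \<mu> \<phi> f)"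
    using assms(1,2) square_integrable by (intro l2_inner_sum_left) auto
  finally show ?thesis by (simp add: power2_eq_square l2_inner_commute)
qed

end

section \<open>Mean of the maximal deviation of a sum\<close>

definition deviation ::
    "'w measure \<Rightarrow> 'i set \<Rightarrow> ('i \<Rightarrow> 'w \<Rightarrow> 'a) \<Rightarrow> ('a \<Rightarrow> real) \<Rightarrow> 'w \<Rightarrow> real" where
  "deviation \<Omega> I X f \<omega> = (\<Sum>i\<in>I. (\<integral>\<omega>'. f (X i \<omega>') \<partial>\<Omega>) - f (X i \<omega>))"

context prob_space
begin

context
  fixes N :: "'b measure" and X :: "'i \<Rightarrow> 'a \<Rightarrow> 'b" and I :: "'i set"
  assumes fin: "finite I" and indep: "indep_vars (\<lambda>_. N) X I"
begin

lemma measurable_observation[measurable]: "i \<in> I \<Longrightarrow> X i \<in> measurable M N"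
  using indep by (simp add: indep_vars_def)

lemma integrable_bounded_component:
  fixes f :: "'b \<Rightarrow> real"
  assumes [measurable]: "f \<in> borel_measurable N" and "\<And>x. x \<in> space N \<Longrightarrow> \<bar>f x\<bar> \<le> B" and i: "i \<in> I"
  shows "integrable M (\<lambda>\<omega>. f (X i \<omega>))"
proof (rule integrable_const_bound)
  show "AE \<omega> in M. norm (f (X i \<omega>)) \<le> B"
    using assms(2) measurable_space[OF measurable_observation[OF i]] by (intro AE_I2) auto
qed (use i in measurable)

lemma abs_expectation_component_le:
  fixes f :: "'b \<Rightarrow> real"
  assumes "f \<in> borel_measurable N" and B: "\<And>x. x \<in> space N \<Longrightarrow> \<bar>f x\<bar> \<le> B" and i: "i \<in> I"
  shows "\<bar>expectation (\<lambda>\<omega>. f (X i \<omega>))\<bar> \<le> B"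
proof -
  have "\<bar>expectation (\<lambda>\<omega>. f (X i \<omega>))\<bar> \<le> expectation (\<lambda>\<omega>. \<bar>f (X i \<omega>)\<bar>)"
    by (rule integral_abs_bound)
  also have "\<dots> \<le> expectation (\<lambda>\<omega>. B)"
    using integrable_bounded_component[OF assms] B measurable_space[OF measurable_observation[OF i]]
    by (intro Bochner_Integration.integral_mono) auto
  finally show ?thesis by (simp add: prob_space)
qed

lemma measurable_deviation[measurable]:
  assumes [measurable]: "f \<in> borel_measurable N"
  shows "deviation M I X f \<in> borel_measurable M"
  unfolding deviation_def by measurable

lemma integrable_deviation:
  assumes "f \<in> borel_measurable N" and "\<And>x. x \<in> space N \<Longrightarrow> \<bar>f x\<bar> \<le> B"
  shows "integrable M (deviation M I X f)"
  unfolding deviation_def using integrable_bounded_component[OF assms] by auto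

text \<open>
  The summands are independent and centred, so the mixed terms of the square vanish and the second
  moment is the sum of the variances.
\<close>

lemma expectation_deviation_square_le:
  assumes f[measurable]: "f \<in> borel_measurable N" and B: "\<And>x. x \<in> space N \<Longrightarrow> \<bar>f x\<bar> \<le> B"
  shows "integrable M (\<lambda>\<omega>. (deviation M I X f \<omega>)\<^sup>2)"
    and "expectation (\<lambda>\<omega>. (deviation M I X f \<omega>)\<^sup>2) \<le> (\<Sum>i\<in>I. expectation (\<lambda>\<omega>. (f (X i \<omega>))\<^sup>2))"
proof -
  define m where "m i = expectation (\<lambda>\<omega>. f (X i \<omega>))" for i
  define Y where "Y i x = m i - f x" for i x
  have Y_meas[measurable]: "Y i \<in> borel_measurable N" for i
    unfolding Y_def by measurable
  have Y_bound: "\<bar>Y i x\<bar> \<le> B + B" if "i \<in> I" "x \<in> space N" for i x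
    using abs_expectation_component_le[OF f B that(1)] B[OF that(2)] by (simp add: Y_def m_def)
  have f2: "integrable M (\<lambda>\<omega>. (f (X i \<omega>))\<^sup>2)" if "i \<in> I" for i
  proof (rule integrable_bounded_component[where f = "\<lambda>x. (f x)\<^sup>2" and B = "B\<^sup>2"])
    show "\<bar>(f x)\<^sup>2\<bar> \<le> B\<^sup>2" if "x \<in> space N" for x
      using B[OF that] by (simp add: abs_le_square_iff[symmetric])
  qed (use that in auto)
  have intf: "integrable M (\<lambda>\<omega>. f (X i \<omega>))" if "i \<in> I" for i
    by (rule integrable_bounded_component[OF f B that])
  have intY: "integrable M (\<lambda>\<omega>. Y i (X i \<omega>))" if "i \<in> I" for i
    using intf[OF that] by (simp add: Y_def)
  have EY: "expectation (\<lambda>\<omega>. Y i (X i \<omega>)) = 0" if "i \<in> I" for i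
    using intf[OF that] by (simp add: Y_def m_def prob_space)
  have intYY: "integrable M (\<lambda>\<omega>. Y i (X i \<omega>) * Y j (X j \<omega>))" if ij: "i \<in> I" "j \<in> I" for i j
  proof (rule integrable_const_bound)
    have "\<bar>Y i (X i \<omega>)\<bar> * \<bar>Y j (X j \<omega>)\<bar> \<le> (B + B) * (B + B)" if "\<omega> \<in> space M" for \<omega>
      using Y_bound[OF ij(1) measurable_space[OF measurable_observation[OF ij(1)] that]]
        Y_bound[OF ij(2) measurable_space[OF measurable_observation[OF ij(2)] that]]
      by (intro mult_mono) auto
    then show "AE \<omega> in M. norm (Y i (X i \<omega>) * Y j (X j \<omega>)) \<le> (B + B) * (B + B)"
      by (intro AE_I2) (simp add: abs_mult)
  qed (use ij in measurable)
  have EYY: "expectation (\<lambda>\<omega>. Y i (X i \<omega>) * Y j (X j \<omega>)) =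
      (if j = i then expectation (\<lambda>\<omega>. (Y i (X i \<omega>))\<^sup>2) else 0)" if ij: "i \<in> I" "j \<in> I" for i j
  proof (cases "i = j")
    case False
    have "indep_vars (\<lambda>_. borel) (\<lambda>k \<omega>. Y k (X k \<omega>)) {i, j}"
      using ij by (intro indep_vars_compose2[OF indep_vars_subset[OF indep]]) auto
    then have "expectation (\<lambda>\<omega>. \<Prod>k\<in>{i, j}. Y k (X k \<omega>)) = (\<Prod>k\<in>{i, j}. expectation (\<lambda>\<omega>. Y k (X k \<omega>)))"
      using intY ij by (intro indep_vars_lebesgue_integral) auto
    with False EY ij show ?thesis by simp
  qed (simp add: power2_eq_square)
  have expand: "(deviation M I X f \<omega>)\<^sup>2 = (\<Sum>i\<in>I. \<Sum>j\<in>I. Y i (X i \<omega>) * Y j (X j \<omega>))" for \<omega>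
    by (simp add: deviation_def Y_def m_def power2_eq_square sum_product)
  show "integrable M (\<lambda>\<omega>. (deviation M I X f \<omega>)\<^sup>2)"
    unfolding expand using intYY by auto
  have "expectation (\<lambda>\<omega>. (deviation M I X f \<omega>)\<^sup>2)
      = (\<Sum>i\<in>I. \<Sum>j\<in>I. expectation (\<lambda>\<omega>. Y i (X i \<omega>) * Y j (X j \<omega>)))"
    unfolding expand using intYY by (simp add: Bochner_Integration.integral_sum)
  also have "\<dots> = (\<Sum>i\<in>I. \<Sum>j\<in>I. if j = i then expectation (\<lambda>\<omega>. (Y i (X i \<omega>))\<^sup>2) else 0)"
    by (intro sum.cong refl EYY)
  also have "\<dots> = (\<Sum>i\<in>I. expectation (\<lambda>\<omega>. (Y i (X i \<omega>))\<^sup>2))"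
    using fin by simp
  also have "\<dots> \<le> (\<Sum>i\<in>I. expectation (\<lambda>\<omega>. (f (X i \<omega>))\<^sup>2))"
  proof (rule sum_mono)
    fix i assume i: "i \<in> I"
    show "expectation (\<lambda>\<omega>. (Y i (X i \<omega>))\<^sup>2) \<le> expectation (\<lambda>\<omega>. (f (X i \<omega>))\<^sup>2)"
      using variance_eq[OF intf[OF i] f2[OF i]] by (simp add: Y_def m_def power2_commute)
  qed
  finally show "expectation (\<lambda>\<omega>. (deviation M I X f \<omega>)\<^sup>2) \<le> (\<Sum>i\<in>I. expectation (\<lambda>\<omega>. (f (X i \<omega>))\<^sup>2))" .
qed

text \<open>
  The deviation is linear in \<open>f\<close>. By the Cauchy-Schwarz inequality for the coefficients, the maximum
  over \<open>F\<close> is at most \<open>sqrt Z\<close>, where \<open>Z\<close> is the sum over \<open>\<Phi>\<close> of the squared deviations; this does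
  not depend on the number of functions in \<open>F\<close>. Each observation contributes to the expectation
  of \<open>Z\<close> at most the supremum of \<open>(\<Sum>\<phi>\<in>\<Phi>. (\<phi> x)\<^sup>2)\<close>, which is bounded by \<open>R\<^sup>2\<close>.
\<close>

lemma expectation_Max_deviation_le:
  assumes \<Phi>: "finite \<Phi>" "\<Phi> \<subseteq> borel_measurable N"
    and R: "R \<ge> 0" "\<And>x. x \<in> space N \<Longrightarrow> (\<Sum>\<phi>\<in>\<Phi>. (\<phi> x)\<^sup>2) \<le> R\<^sup>2"
    and F: "finite F" "F \<noteq> {}" "F \<subseteq> borel_measurable N"
    and expand: "\<And>f x. f \<in> F \<Longrightarrow> x \<in> space N \<Longrightarrow> f x = (\<Sum>\<phi>\<in>\<Phi>. a f \<phi> * \<phi> x)"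
    and coeff: "\<And>f. f \<in> F \<Longrightarrow> (\<Sum>\<phi>\<in>\<Phi>. (a f \<phi>)\<^sup>2) \<le> 1"
  shows "expectation (\<lambda>\<omega>. Max ((\<lambda>f. deviation M I X f \<omega>) ` F)) \<le> R * sqrt (card I)"
proof -
  have \<phi>R: "\<bar>\<phi> x\<bar> \<le> R" if "\<phi> \<in> \<Phi>" "x \<in> space N" for \<phi> x
  proof -
    have "(\<phi> x)\<^sup>2 \<le> (\<Sum>\<phi>\<in>\<Phi>. (\<phi> x)\<^sup>2)"
      using \<Phi>(1) that(1) by (intro member_le_sum) auto
    with R that(2) show ?thesis by (intro power2_le_iff_abs_le[THEN iffD1]) force+
  qed
  have \<phi>_meas: "\<phi> \<in> borel_measurable N" if "\<phi> \<in> \<Phi>" for \<phi> using \<Phi> that by auto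
  have int\<phi>: "integrable M (\<lambda>\<omega>. \<phi> (X i \<omega>))" if "\<phi> \<in> \<Phi>" "i \<in> I" for \<phi> i
    using integrable_bounded_component[where f = \<phi> and B = R] \<phi>_meas \<phi>R that by blast
  have dev2: "integrable M (\<lambda>\<omega>. (deviation M I X \<phi> \<omega>)\<^sup>2)"
    "expectation (\<lambda>\<omega>. (deviation M I X \<phi> \<omega>)\<^sup>2) \<le> (\<Sum>i\<in>I. expectation (\<lambda>\<omega>. (\<phi> (X i \<omega>))\<^sup>2))"
    if "\<phi> \<in> \<Phi>" for \<phi>
    using expectation_deviation_square_le[where f = \<phi> and B = R] \<phi>_meas \<phi>R that by blast+
  define Z where "Z \<omega> = (\<Sum>\<phi>\<in>\<Phi>. (deviation M I X \<phi> \<omega>)\<^sup>2)" for \<omega>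
  have Z0: "Z \<omega> \<ge> 0" for \<omega> by (simp add: Z_def sum_nonneg)
  have intZ: "integrable M Z"
    unfolding Z_def using dev2(1)
    by (intro Bochner_Integration.integrable_sum) auto
  then have [measurable]: "Z \<in> borel_measurable M" by auto
  have EZ: "expectation Z \<le> R\<^sup>2 * card I"
  proof -
    have int2: "integrable M (\<lambda>\<omega>. (\<phi> (X i \<omega>))\<^sup>2)" if "\<phi> \<in> \<Phi>" "i \<in> I" for \<phi> i
      using \<phi>_meas[OF that(1)] \<phi>R[OF that(1)] that(2) R(1)
      by (intro integrable_bounded_component[where f = "\<lambda>x. (\<phi> x)\<^sup>2" and B = "R\<^sup>2"])
         (auto simp: abs_le_square_iff[symmetric])
    have "expectation Z = (\<Sum>\<phi>\<in>\<Phi>. expectation (\<lambda>\<omega>. (deviation M I X \<phi> \<omega>)\<^sup>2))"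
      unfolding Z_def using dev2(1)
      by (intro Bochner_Integration.integral_sum) auto
    also have "\<dots> \<le> (\<Sum>\<phi>\<in>\<Phi>. \<Sum>i\<in>I. expectation (\<lambda>\<omega>. (\<phi> (X i \<omega>))\<^sup>2))"
      by (intro sum_mono dev2(2))
    also have "\<dots> = (\<Sum>i\<in>I. expectation (\<lambda>\<omega>. \<Sum>\<phi>\<in>\<Phi>. (\<phi> (X i \<omega>))\<^sup>2))"
      using int2 by (subst sum.swap) (simp add: Bochner_Integration.integral_sum)
    also have "\<dots> \<le> (\<Sum>i\<in>I. expectation (\<lambda>\<omega>. R\<^sup>2))"
      using int2 R(2) measurable_space[OF measurable_observation]
      by (intro sum_mono Bochner_Integration.integral_mono Bochner_Integration.integrable_sum) auto
    finally show ?thesis by (simp add: prob_space mult.commute)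
  qed
  have int_sqrt: "integrable M (\<lambda>\<omega>. sqrt (Z \<omega>))"
  proof (rule Bochner_Integration.integrable_bound)
    show "integrable M (\<lambda>\<omega>. Z \<omega> + 1)" using intZ by simp
    have "sqrt (Z \<omega>) \<le> Z \<omega> + 1" for \<omega>
      using arith_geo_mean_sqrt[OF Z0 zero_le_one, of \<omega>] Z0[of \<omega>] by simp
    then show "AE \<omega> in M. norm (sqrt (Z \<omega>)) \<le> norm (Z \<omega> + 1)"
      using Z0 by (intro AE_I2) (simp add: add_nonneg_nonneg)
  qed simp
  \<comment> \<open>Jensen for the square, in the form of a nonnegative variance\<close>
  have "(expectation (\<lambda>\<omega>. sqrt (Z \<omega>)))\<^sup>2 \<le> expectation Z"
    using variance_eq[OF int_sqrt] variance_positive[of "\<lambda>\<omega>. sqrt (Z \<omega>)"] intZ Z0 by simp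
  then have "(expectation (\<lambda>\<omega>. sqrt (Z \<omega>)))\<^sup>2 \<le> R\<^sup>2 * card I"
    using EZ by (rule order_trans)
  from real_le_rsqrt[OF this] have E_sqrt: "expectation (\<lambda>\<omega>. sqrt (Z \<omega>)) \<le> R * sqrt (card I)"
    using R(1) by (simp add: real_sqrt_mult)
  have dev: "deviation M I X f \<omega> \<le> sqrt (Z \<omega>)" if f: "f \<in> F" and \<omega>: "\<omega> \<in> space M" for f \<omega>
  proof -
    have "expectation (\<lambda>\<omega>. f (X i \<omega>)) - f (X i \<omega>)
        = (\<Sum>\<phi>\<in>\<Phi>. a f \<phi> * (expectation (\<lambda>\<omega>. \<phi> (X i \<omega>)) - \<phi> (X i \<omega>)))" if i: "i \<in> I" for i
    proof -
      have "expectation (\<lambda>\<omega>. f (X i \<omega>)) = expectation (\<lambda>\<omega>. \<Sum>\<phi>\<in>\<Phi>. a f \<phi> * \<phi> (X i \<omega>))"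
        using measurable_space[OF measurable_observation[OF i]] f by (intro Bochner_Integration.integral_cong) (auto intro: expand)
      also have "\<dots> = (\<Sum>\<phi>\<in>\<Phi>. a f \<phi> * expectation (\<lambda>\<omega>. \<phi> (X i \<omega>)))"
        using int\<phi> i by (simp add: Bochner_Integration.integral_sum)
      finally show ?thesis
        using expand[OF f measurable_space[OF measurable_observation[OF i] \<omega>]]
        by (simp add: right_diff_distrib sum_subtractf)
    qed
    then have "deviation M I X f \<omega> = (\<Sum>\<phi>\<in>\<Phi>. a f \<phi> * deviation M I X \<phi> \<omega>)"
      by (simp add: deviation_def sum_distrib_left sum.swap[of _ \<Phi>])
    moreover have "(\<Sum>\<phi>\<in>\<Phi>. a f \<phi> * deviation M I X \<phi> \<omega>)\<^sup>2 \<le> (\<Sum>\<phi>\<in>\<Phi>. (a f \<phi>)\<^sup>2) * Z \<omega>"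
      unfolding Z_def by (rule Cauchy_Schwarz_ineq_sum)
    moreover have "\<dots> \<le> 1 * Z \<omega>"
      using coeff[OF f] Z0 by (intro mult_right_mono)
    ultimately have "(deviation M I X f \<omega>)\<^sup>2 \<le> Z \<omega>" by simp
    then show ?thesis by (rule real_le_rsqrt)
  qed
  have meas_F: "f \<in> borel_measurable N" if "f \<in> F" for f using F that by auto
  have int_Max: "integrable M (\<lambda>\<omega>. Max ((\<lambda>f. deviation M I X f \<omega>) ` F))"
  proof (rule Bochner_Integration.integrable_bound)
    show "integrable M (\<lambda>\<omega>. \<Sum>f\<in>F. \<bar>deviation M I X f \<omega>\<bar>)"
    proof (intro Bochner_Integration.integrable_sum integrable_abs)
      fix f assume f: "f \<in> F"
      have "\<bar>f x\<bar> \<le> (\<Sum>\<phi>\<in>\<Phi>. \<bar>a f \<phi>\<bar> * R)" if "x \<in> space N" for x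
        unfolding expand[OF f that] using \<phi>R that
        by (intro order_trans[OF sum_abs] sum_mono) (auto simp: abs_mult intro: mult_left_mono)
      from integrable_deviation[OF meas_F[OF f] this] show "integrable M (deviation M I X f)" .
    qed
    show "(\<lambda>\<omega>. Max ((\<lambda>f. deviation M I X f \<omega>) ` F)) \<in> borel_measurable M"
      using F(1) meas_F by (intro borel_measurable_Max) auto
    have "\<bar>Max ((\<lambda>f. deviation M I X f \<omega>) ` F)\<bar> \<le> (\<Sum>f\<in>F. \<bar>deviation M I X f \<omega>\<bar>)" for \<omega>
    proof -
      have "Max ((\<lambda>f. deviation M I X f \<omega>) ` F) \<in> (\<lambda>f. deviation M I X f \<omega>) ` F"
        using F by (intro Max_in) auto
      then obtain f where "f \<in> F" "Max ((\<lambda>f. deviation M I X f \<omega>) ` F) = deviation M I X f \<omega>" by auto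
      then show ?thesis using F(1) member_le_sum[of f F "\<lambda>f. \<bar>deviation M I X f \<omega>\<bar>"] by simp
    qed
    then show "AE \<omega> in M. norm (Max ((\<lambda>f. deviation M I X f \<omega>) ` F)) \<le> norm (\<Sum>f\<in>F. \<bar>deviation M I X f \<omega>\<bar>)"
      by (simp add: sum_nonneg)
  qed
  have "expectation (\<lambda>\<omega>. Max ((\<lambda>f. deviation M I X f \<omega>) ` F)) \<le> expectation (\<lambda>\<omega>. sqrt (Z \<omega>))"
    using dev F by (intro Bochner_Integration.integral_mono int_Max int_sqrt) auto
  also note E_sqrt
  finally show ?thesis .
qed

end

end

section \<open>Uniform deviations over the unit ball\<close>

lemma abs_Max_diff_le:
  fixes u v :: "'b \<Rightarrow> real"
  assumes F: "finite F" "F \<noteq> {}" and le: "\<And>f. f \<in> F \<Longrightarrow> \<bar>u f - v f\<bar> \<le> c"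
  shows "\<bar>Max (u ` F) - Max (v ` F)\<bar> \<le> c"
proof -
  have "Max (u ` F) \<le> Max (v ` F) + c" if "\<And>f. f \<in> F \<Longrightarrow> \<bar>u f - v f\<bar> \<le> c" for u v :: "'b \<Rightarrow> real"
  proof (rule Max.boundedI)
    fix a assume "a \<in> u ` F"
    then obtain f where f: "f \<in> F" "a = u f" by auto
    then have "v f \<le> Max (v ` F)" using F by simp
    with that[OF f(1)] f(2) show "a \<le> Max (v ` F) + c" by simp
  qed (use F in auto)
  from this[of u v] this[of v u] le show ?thesis by (simp add: abs_minus_commute abs_le_iff)
qed

context bounded_l2_subspace
begin

lemma borel_measurable_mem: "f \<in> V \<Longrightarrow> f \<in> borel_measurable \<mu>"
  using square_integrable by (auto simp: Lspace_2_iff)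

lemma abs_le_R: "\<bar>f x\<bar> \<le> R" if "f \<in> V" "Lnorm \<mu> 2 f \<le> 1" "x \<in> space \<mu>"
proof -
  have "R * Lnorm \<mu> 2 f \<le> R * 1" using that(2) R_pos by (intro mult_left_mono) auto
  with abs_le_Lnorm[OF that(1,3)] show ?thesis by simp
qed

text \<open>
  The maximal deviation exceeds its mean, at most \<open>R * sqrt (card I)\<close>, by at least
  \<open>t = R * sqrt (2 * \<xi> * card I)\<close> with probability at most
  \<open>exp (- \<xi>)\<close>: functions of the unit ball of \<open>V\<close> are bounded by \<open>R\<close>, so changing one observation
  changes the maximum by at most \<open>2 * R\<close> and McDiarmid's inequality applies.
\<close>

lemma finite_deviation_bound:
  assumes \<Omega>: "prob_space \<Omega>" and I: "finite I" "I \<noteq> {}"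
    and indep: "prob_space.indep_vars \<Omega> (\<lambda>_. \<mu>) X I"
    and F: "finite F" "F \<subseteq> V" and norm: "\<And>f. f \<in> F \<Longrightarrow> Lnorm \<mu> 2 f \<le> 1" and \<xi>: "\<xi> > 0"
  shows "measure \<Omega> {\<omega> \<in> space \<Omega>. \<exists>f\<in>F. deviation \<Omega> I X f \<omega> > R * sqrt (card I) * (1 + sqrt (2 * \<xi>))}
    \<le> exp (- \<xi>)"
proof (cases "F = {}")
  case False
  interpret prob_space \<Omega> by fact
  have FV: "f \<in> V" if "f \<in> F" for f using F that by auto
  have F_meas[measurable]: "f \<in> borel_measurable \<mu>" if "f \<in> F" for f
    using borel_measurable_mem FV[OF that] .
  have f_le: "\<bar>f x\<bar> \<le> R" if "f \<in> F" "x \<in> space \<mu>" for f x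
    by (rule abs_le_R[OF FV norm]) (use that in auto)
  have card_pos: "card I > 0" using I by (simp add: card_gt_0_iff)
  define m where "m i f = (\<integral>\<omega>. f (X i \<omega>) \<partial>\<Omega>)" for i and f :: "'a \<Rightarrow> real"
  define h where "h f x = (\<Sum>i\<in>I. m i f - f (x i))" for f x
  define g where "g x = Max ((\<lambda>f. h f x) ` F)" for x
  define Y where "Y \<omega> = g (\<lambda>i\<in>I. X i \<omega>)" for \<omega>
  have Y_eq: "Y \<omega> = Max ((\<lambda>f. deviation \<Omega> I X f \<omega>) ` F)" for \<omega>
    by (simp add: Y_def g_def h_def m_def deviation_def)

  obtain \<Phi> where \<Phi>: "finite \<Phi>" "\<Phi> \<subseteq> V"
    and on: "\<And>\<phi> \<psi>. \<phi> \<in> \<Phi> \<Longrightarrow> \<psi> \<in> \<Phi> \<Longrightarrow> l2_inner \<mu> \<phi> \<psi> = (if \<phi> = \<psi> then 1 else 0)"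
    and ex: "\<And>f x. f \<in> F \<Longrightarrow> x \<in> space \<mu> \<Longrightarrow> f x = (\<Sum>\<phi>\<in>\<Phi>. l2_inner \<mu> f \<phi> * \<phi> x)"
    by (rule orthonormal_expansion[OF F]) (rule that)
  have EY: "expectation Y \<le> R * sqrt (card I)"
    unfolding Y_eq
  proof (rule expectation_Max_deviation_le[OF I(1) indep \<Phi>(1)])
    show "(\<Sum>\<phi>\<in>\<Phi>. (\<phi> x)\<^sup>2) \<le> R\<^sup>2" if "x \<in> space \<mu>" for x
      by (rule sum_orthonormal_square_le[OF \<Phi> on that])
    show "(\<Sum>\<phi>\<in>\<Phi>. (l2_inner \<mu> f \<phi>)\<^sup>2) \<le> 1" if f: "f \<in> F" for f
    proof -
      have "(\<Sum>\<phi>\<in>\<Phi>. (l2_inner \<mu> f \<phi>)\<^sup>2) = (Lnorm \<mu> 2 f)\<^sup>2"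
        by (rule sum_coefficients_square[OF \<Phi>(2) FV[OF f] ex[OF f]])
      also have "\<dots> \<le> 1" by (intro power_le_one Lnorm_2_nonneg norm[OF f])
      finally show ?thesis .
    qed
    show "f x = (\<Sum>\<phi>\<in>\<Phi>. l2_inner \<mu> f \<phi> * \<phi> x)" if "f \<in> F" "x \<in> space \<mu>" for f x
      by (rule ex[OF that])
  qed (use R_pos \<Phi> F False borel_measurable_mem in auto)

  \<comment> \<open>chosen so that the exponent \<open>2 * t\<^sup>2 / (card I * (2 * R)\<^sup>2)\<close> equals \<open>\<xi>\<close>\<close>
  define t where "t = R * sqrt (2 * \<xi> * card I)"
  have t: "t > 0" using R_pos \<xi> card_pos by (simp add: t_def)
  have d: "(\<Sum>i\<in>I. (2 * R)\<^sup>2) > 0" using R_pos card_pos by simp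
  have g_meas: "g \<in> borel_measurable (PiM I (\<lambda>_. \<mu>))"
    unfolding g_def h_def using F(1) by (intro borel_measurable_Max) measurable
  have h_diff: "\<bar>h f (x(i := y)) - h f x\<bar> \<le> 2 * R"
    if "f \<in> F" "i \<in> I" "x \<in> space (PiM I (\<lambda>_. \<mu>))" "y \<in> space \<mu>" for f i x y
  proof -
    have "h f (x(i := y)) - h f x = (\<Sum>k\<in>I. if k = i then f (x i) - f y else 0)"
      unfolding h_def sum_subtractf[symmetric] by (intro sum.cong) auto
    also have "\<dots> = f (x i) - f y" using I that by simp
    finally have "h f (x(i := y)) - h f x = f (x i) - f y" .
    moreover have "x i \<in> space \<mu>" using that by (auto simp: space_PiM)
    ultimately show ?thesis using f_le[OF that(1), of "x i"] f_le[OF that(1), of y] that(4) by simp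
  qed
  have h_bound: "\<bar>h f x\<bar> \<le> card I * (2 * R)" if "f \<in> F" "x \<in> space (PiM I (\<lambda>_. \<mu>))" for f x
  proof -
    have "\<bar>m i f - f (x i)\<bar> \<le> 2 * R" if i: "i \<in> I" for i
    proof -
      have "\<bar>m i f\<bar> \<le> R"
        unfolding m_def using abs_expectation_component_le[OF I(1) indep, of f R i] F_meas f_le \<open>f \<in> F\<close> i
        by blast
      moreover have "\<bar>f (x i)\<bar> \<le> R" using f_le[OF \<open>f \<in> F\<close>] \<open>x \<in> _\<close> i by (auto simp: space_PiM)
      ultimately show ?thesis by simp
    qed
    then have "(\<Sum>i\<in>I. \<bar>m i f - f (x i)\<bar>) \<le> card I * (2 * R)"
      by (intro order_trans[OF sum_bounded_above]) auto
    then show ?thesis unfolding h_def by (rule order_trans[OF sum_abs])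
  qed
  have "prob {\<omega> \<in> space \<Omega>. Y \<omega> \<ge> expectation Y + t} \<le> exp (- 2 * t\<^sup>2 / (\<Sum>i\<in>I. (2 * R)\<^sup>2))"
    unfolding Y_def
  proof (rule mcdiarmid_inequality[OF I indep g_meas _ _ t d])
    show "\<bar>g x\<bar> \<le> card I * (2 * R)" if "x \<in> space (PiM I (\<lambda>_. \<mu>))" for x
    proof -
      have "g x \<in> (\<lambda>f. h f x) ` F" unfolding g_def using F False by (intro Max_in) auto
      with h_bound that show ?thesis by auto
    qed
    show "\<bar>g (x(i := y)) - g x\<bar> \<le> 2 * R"
      if "i \<in> I" "x \<in> space (PiM I (\<lambda>_. \<mu>))" "y \<in> space \<mu>" for i x y
      unfolding g_def by (intro abs_Max_diff_le F(1) False h_diff that)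
  qed
  also have "- 2 * t\<^sup>2 / (\<Sum>i\<in>I. (2 * R)\<^sup>2) = - \<xi>"
    using R_pos \<xi> card_pos by (simp add: t_def power_mult_distrib)
  finally have *: "prob {\<omega> \<in> space \<Omega>. Y \<omega> \<ge> expectation Y + t} \<le> exp (- \<xi>)" .
  have [measurable]: "Y \<in> borel_measurable \<Omega>"
    unfolding Y_eq using F(1) by (intro borel_measurable_Max measurable_deviation[OF I(1) indep]) auto
  have "R * sqrt (card I) * (1 + sqrt (2 * \<xi>)) \<ge> expectation Y + t"
    using EY by (simp add: t_def real_sqrt_mult algebra_simps)
  moreover have dev_le: "deviation \<Omega> I X f \<omega> \<le> Y \<omega>" if "f \<in> F" for f \<omega>
    unfolding Y_eq using F(1) that by (intro Max_ge) auto
  ultimately have "{\<omega> \<in> space \<Omega>. \<exists>f\<in>F. deviation \<Omega> I X f \<omega> > R * sqrt (card I) * (1 + sqrt (2 * \<xi>))}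
      \<subseteq> {\<omega> \<in> space \<Omega>. Y \<omega> \<ge> expectation Y + t}"
  proof safe
    fix \<omega> f assume "f \<in> F" "deviation \<Omega> I X f \<omega> > R * sqrt (card I) * (1 + sqrt (2 * \<xi>))"
      and le: "expectation Y + t \<le> R * sqrt (card I) * (1 + sqrt (2 * \<xi>))"
    with dev_le[of f \<omega>] show "Y \<omega> \<ge> expectation Y + t" by linarith
  qed
  then have "prob {\<omega> \<in> space \<Omega>. \<exists>f\<in>F. deviation \<Omega> I X f \<omega> > R * sqrt (card I) * (1 + sqrt (2 * \<xi>))}
      \<le> prob {\<omega> \<in> space \<Omega>. Y \<omega> \<ge> expectation Y + t}"
    by (intro finite_measure_mono) auto
  with * show ?thesis by simp
qed simp

text \<open>
  The finite bound does not depend on the number of functions, hence it survives an increasing union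
  over the finite initial segments of an enumeration of \<open>F\<close>.
\<close>

lemma countable_deviation_bound:
  assumes \<Omega>: "prob_space \<Omega>" and I: "finite I" "I \<noteq> {}"
    and indep: "prob_space.indep_vars \<Omega> (\<lambda>_. \<mu>) X I"
    and F: "countable F" "F \<subseteq> V" and norm: "\<And>f. f \<in> F \<Longrightarrow> Lnorm \<mu> 2 f \<le> 1" and \<xi>: "\<xi> > 0"
  defines "bad \<equiv> {\<omega> \<in> space \<Omega>. \<exists>f\<in>F. deviation \<Omega> I X f \<omega> > R * sqrt (card I) * (1 + sqrt (2 * \<xi>))}"
  shows "bad \<in> sets \<Omega>" and "measure \<Omega> bad \<le> exp (- \<xi>)"
proof -
  interpret prob_space \<Omega> by fact
  define c where "c = R * sqrt (card I) * (1 + sqrt (2 * \<xi>))"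
  have [measurable]: "deviation \<Omega> I X f \<in> borel_measurable \<Omega>" if "f \<in> F" for f
    using measurable_deviation[OF I(1) indep] borel_measurable_mem F(2) that by blast
  show "bad \<in> sets \<Omega>"
    unfolding bad_def using F(1) by measurable
  show "measure \<Omega> bad \<le> exp (- \<xi>)"
  proof (cases "F = {}")
    case False
    define A where "A k = {\<omega> \<in> space \<Omega>. \<exists>f\<in>from_nat_into F ` {..k}. deviation \<Omega> I X f \<omega> > c}" for k :: nat
    have mem: "from_nat_into F k \<in> F" for k using False by (rule from_nat_into)
    have "(\<lambda>k. prob (A k)) \<longlonglongrightarrow> prob (\<Union>k. A k)"
    proof (rule finite_Lim_measure_incseq)
      show "range A \<subseteq> sets \<Omega>" unfolding A_def using mem by auto
      show "incseq A" unfolding A_def by (force simp: incseq_def)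
    qed
    moreover have "prob (A k) \<le> exp (- \<xi>)" for k
      unfolding A_def c_def using mem F(2) norm
      by (intro finite_deviation_bound[OF \<Omega> I indep _ _ _ \<xi>]) auto
    ultimately have "prob (\<Union>k. A k) \<le> exp (- \<xi>)" by (intro LIMSEQ_le_const2) auto
    moreover have "(\<Union>k. A k) = bad"
      using range_from_nat_into[OF False F(1)] by (auto simp: A_def bad_def c_def) (metis imageE order_refl atMost_iff)
    ultimately show ?thesis by simp
  qed (simp add: bad_def)
qed

end

section \<open>Tests between two densities\<close>

text \<open>
  Densities of the same signed measure agree almost everywhere, so their \<open>L2\<close> distance is zero, and the
  metric on \<open>V\<close> separates points. Hence the density chosen from a measure of the model is the
  intended one.
\<close>

lemma inj_on_sdensity:
  assumes V: "V \<subseteq> Lspace \<mu> 1" and metric: "Metric_space V (\<lambda>f g. Lnorm \<mu> 2 (\<lambda>x. f x - g x))"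
  shows "inj_on (sdensity \<mu>) V"
proof (rule inj_onI)
  fix p q assume p: "p \<in> V" and q: "q \<in> V" and eq: "sdensity \<mu> p = sdensity \<mu> q"
  have int: "integrable \<mu> p" "integrable \<mu> q"
    using subsetD[OF V p] subsetD[OF V q] by (auto simp: Lspace_def integrable_abs_iff)
  have "AE x in \<mu>. p x = q x"
  proof (rule density_unique_real[OF int])
    fix A assume "A \<in> sets \<mu>"
    with fun_cong[OF eq, of A] show "(LINT x:A|\<mu>. p x) = (LINT x:A|\<mu>. q x)"
      by (simp add: sdensity_def)
  qed
  then have "(\<integral>x. \<bar>p x - q x\<bar> ^ 2 \<partial>\<mu>) = 0"
    by (intro integral_eq_zero_AE) auto
  then have "Lnorm \<mu> 2 (\<lambda>x. p x - q x) = 0" by (simp add: Lnorm_def)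
  then show "p = q" using Metric_space.zero[OF metric p q] by simp
qed

text \<open>
  For \<open>p = q\<close>, and whenever the norm vanishes, division by zero yields the zero function, in accordance
  with the convention \<open>f\<^bsub>(P,P)\<^esub> = 0\<close> for the test functions.
\<close>

definition unit_diff :: "'a measure \<Rightarrow> ('a \<Rightarrow> real) \<Rightarrow> ('a \<Rightarrow> real) \<Rightarrow> 'a \<Rightarrow> real" where
  "unit_diff \<mu> p q x = (p x - q x) / Lnorm \<mu> 2 (\<lambda>y. p y - q y)"

lemma unit_diff_commute: "unit_diff \<mu> q p x = - unit_diff \<mu> p q x"
  by (simp add: unit_diff_def Lnorm_2_diff_commute[of \<mu> q p] minus_divide_left)

lemma Lnorm_unit_diff_le: "Lnorm \<mu> 2 (unit_diff \<mu> p q) \<le> 1"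
  using Lnorm_2_cmult[of \<mu> "1 / Lnorm \<mu> 2 (\<lambda>y. p y - q y)" "\<lambda>y. p y - q y"] Lnorm_2_nonneg[of \<mu> "\<lambda>y. p y - q y"]
  by (simp add: unit_diff_def[abs_def])

lemma l2_t_eq:
  assumes inj: "inj_on (sdensity \<mu>) M" and p: "p \<in> M" and q: "q \<in> M"
  shows "l2_t \<mu> M R (sdensity \<mu> p) (sdensity \<mu> q) x =
    (l2_inner \<mu> (unit_diff \<mu> p q) (\<lambda>y. (p y + q y) / 2) - unit_diff \<mu> p q x) / (2 * R)"
proof -
  have dens: "dens \<mu> M (sdensity \<mu> p) = p" "dens \<mu> M (sdensity \<mu> q) = q"
    unfolding dens_def using inj p q by simp_all
  have "l2_f \<mu> M (sdensity \<mu> p) (sdensity \<mu> q) = unit_diff \<mu> p q"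
    by (rule ext) (auto simp: l2_f_def dens unit_diff_def inj_on_eq_iff[OF inj p q])
  then show ?thesis by (simp add: l2_t_def dens l2_inner_def)
qed

lemma l2_t_commute:
  assumes "inj_on (sdensity \<mu>) M" "p \<in> M" "q \<in> M"
  shows "l2_t \<mu> M R (sdensity \<mu> q) (sdensity \<mu> p) x = - l2_t \<mu> M R (sdensity \<mu> p) (sdensity \<mu> q) x"
proof -
  have "l2_inner \<mu> (unit_diff \<mu> q p) (\<lambda>y. (q y + p y) / 2) = - l2_inner \<mu> (unit_diff \<mu> p q) (\<lambda>y. (p y + q y) / 2)"
    by (simp add: l2_inner_def unit_diff_commute[of \<mu> q p] add.commute)
  with assms show ?thesis
    by (simp add: l2_t_eq unit_diff_commute[of \<mu> q p] minus_divide_left)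
qed

text \<open>
  With \<open>d = p - q\<close> and \<open>f = d / \<parallel>d\<parallel>\<close>, write \<open>(p + q) / 2 - s = (p - s) - d / 2\<close>. The inner product of \<open>f\<close> with
  the first term is at most \<open>\<parallel>p - s\<parallel>\<close> and with \<open>d\<close> it is \<open>\<parallel>d\<parallel>\<close>, which is at least
  \<open>\<parallel>s - q\<parallel> - \<parallel>s - p\<parallel>\<close>. This is the reason why the sign of the expected test statistic tells which of
  \<open>p\<close> and \<open>q\<close> is closer to \<open>s\<close>, up to a factor of 3.
\<close>

lemma unit_diff_inner_le:
  assumes p: "p \<in> Lspace \<mu> 2" and q: "q \<in> Lspace \<mu> 2" and s: "s \<in> Lspace \<mu> 2"
  shows "l2_inner \<mu> (unit_diff \<mu> p q) (\<lambda>y. (p y + q y) / 2) - l2_inner \<mu> (unit_diff \<mu> p q) s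
    \<le> 3 / 2 * Lnorm \<mu> 2 (\<lambda>x. s x - p x) - 1 / 2 * Lnorm \<mu> 2 (\<lambda>x. s x - q x)"
proof -
  define d where "d = (\<lambda>x. p x - q x)"
  define N where "N = Lnorm \<mu> 2 d"
  define f where "f = unit_diff \<mu> p q"
  define r where "r = (\<lambda>x. p x - s x)"
  have f_eq: "f = (\<lambda>x. 1 / N * d x)" by (auto simp: f_def unit_diff_def N_def d_def)
  have L: "d \<in> Lspace \<mu> 2" "r \<in> Lspace \<mu> 2" "f \<in> Lspace \<mu> 2"
    unfolding f_eq unfolding d_def r_def by (intro Lspace_2_diff Lspace_2_cmult p q s)+
  have half: "(\<lambda>x. 1 / 2 * d x) \<in> Lspace \<mu> 2" by (rule Lspace_2_cmult[OF L(1)])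
  have rs: "(\<lambda>x. r x + s x) \<in> Lspace \<mu> 2" by (rule Lspace_2_add[OF L(2) s])
  have fd: "l2_inner \<mu> f d = N"
  proof -
    have "l2_inner \<mu> f d = 1 / N * N\<^sup>2"
      unfolding f_eq N_def Lnorm_2_square by (rule l2_inner_cmult_left)
    then show ?thesis by (simp add: power2_eq_square)
  qed
  have "(\<lambda>y. (p y + q y) / 2) = (\<lambda>y. (r y + s y) - 1 / 2 * d y)"
    by (auto simp: r_def d_def field_simps)
  then have "l2_inner \<mu> f (\<lambda>y. (p y + q y) / 2) = l2_inner \<mu> f r + l2_inner \<mu> f s - 1 / 2 * N"
    using L half rs s fd
    by (simp only: l2_inner_diff_right l2_inner_add_right l2_inner_cmult_right)
  moreover have "l2_inner \<mu> f r \<le> Lnorm \<mu> 2 r"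
  proof -
    have "l2_inner \<mu> f r \<le> Lnorm \<mu> 2 f * Lnorm \<mu> 2 r" using L by (intro l2_cauchy_schwarz)
    also have "\<dots> \<le> 1 * Lnorm \<mu> 2 r"
      unfolding f_def by (intro mult_right_mono Lnorm_unit_diff_le Lnorm_2_nonneg)
    finally show ?thesis by simp
  qed
  moreover have "Lnorm \<mu> 2 r = Lnorm \<mu> 2 (\<lambda>x. s x - p x)"
    unfolding r_def by (rule Lnorm_2_diff_commute)
  moreover have "Lnorm \<mu> 2 (\<lambda>x. s x - q x) \<le> Lnorm \<mu> 2 (\<lambda>x. s x - p x) + N"
    using Lnorm_2_triangle[OF Lspace_2_diff[OF s p] L(1)] by (simp add: N_def d_def)
  ultimately show ?thesis unfolding f_def by simp
qed

lemma expectation_eq_l2_inner: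
  assumes "distributed \<Omega> \<mu> X (\<lambda>x. ennreal (s x))" and "AE x in \<mu>. 0 \<le> s x"
    and [measurable]: "s \<in> borel_measurable \<mu>" "f \<in> borel_measurable \<mu>"
  shows "(\<integral>\<omega>. f (X \<omega>) \<partial>\<Omega>) = l2_inner \<mu> f s"
proof -
  have [measurable]: "X \<in> measurable \<Omega> \<mu>" using assms(1) by (rule distributed_measurable)
  have "(\<integral>\<omega>. f (X \<omega>) \<partial>\<Omega>) = (\<integral>x. f x \<partial>distr \<Omega> \<mu> X)" by (simp add: integral_distr)
  also have "\<dots> = (\<integral>x. f x \<partial>density \<mu> (\<lambda>x. ennreal (s x)))"
    using distributed_distr_eq_density[OF assms(1)] by simp
  also have "\<dots> = (\<integral>x. s x * f x \<partial>\<mu>)" using assms(2) by (simp add: integral_real_density)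
  finally show ?thesis by (simp add: l2_inner_def mult.commute)
qed

text \<open>
  The test statistic is the sum of its mean, controlled by \<open>unit_diff_inner_le\<close>, and of a centred part
  which is the deviation of the test function.
\<close>

lemma l2_t_sum_le:
  assumes "inj_on (sdensity \<mu>) M" and M: "M \<subseteq> Lspace \<mu> 2" and p: "p \<in> M" and q: "q \<in> M" and R: "R > 0"
    and s: "\<And>i. i \<in> {1..n} \<Longrightarrow> s i \<in> Lspace \<mu> 2"
      "\<And>i. i \<in> {1..n} \<Longrightarrow> AE x in \<mu>. 0 \<le> s i x"
      "\<And>i. i \<in> {1..n} \<Longrightarrow> distributed \<Omega> \<mu> (X i) (\<lambda>x. ennreal (s i x))"
    and dev: "deviation \<Omega> {1..n} X (unit_diff \<mu> p q) \<omega> \<le> c"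
  shows "2 * R * (\<Sum>i=1..n. l2_t \<mu> M R (sdensity \<mu> p) (sdensity \<mu> q) (X i \<omega>))
    \<le> 3 / 2 * (\<Sum>i=1..n. Lnorm \<mu> 2 (\<lambda>x. s i x - p x))
      - 1 / 2 * (\<Sum>i=1..n. Lnorm \<mu> 2 (\<lambda>x. s i x - q x)) + c"
proof -
  define f where "f = unit_diff \<mu> p q"
  define b where "b = l2_inner \<mu> f (\<lambda>y. (p y + q y) / 2)"
  have pq: "p \<in> Lspace \<mu> 2" "q \<in> Lspace \<mu> 2" using M p q by auto
  have f_meas: "f \<in> borel_measurable \<mu>"
    using pq unfolding f_def unit_diff_def[abs_def] by (auto simp: Lspace_2_iff)
  have E: "(\<integral>\<omega>'. f (X i \<omega>') \<partial>\<Omega>) = l2_inner \<mu> f (s i)" if "i \<in> {1..n}" for i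
    using s that f_meas by (intro expectation_eq_l2_inner) (auto simp: Lspace_2_iff)
  have "2 * R * (\<Sum>i=1..n. l2_t \<mu> M R (sdensity \<mu> p) (sdensity \<mu> q) (X i \<omega>))
      = (\<Sum>i=1..n. b - f (X i \<omega>))"
    using R by (simp add: l2_t_eq[OF assms(1) p q] b_def f_def sum_divide_distrib[symmetric])
  also have "\<dots> = (\<Sum>i=1..n. b - l2_inner \<mu> f (s i)) + deviation \<Omega> {1..n} X f \<omega>"
    unfolding deviation_def sum.distrib[symmetric] by (intro sum.cong refl) (simp add: E)
  also have "\<dots> \<le> (\<Sum>i=1..n. 3 / 2 * Lnorm \<mu> 2 (\<lambda>x. s i x - p x) - 1 / 2 * Lnorm \<mu> 2 (\<lambda>x. s i x - q x)) + c"
    using dev unfolding b_def f_def by (intro add_mono sum_mono unit_diff_inner_le pq s)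
  also have "\<dots> = 3 / 2 * (\<Sum>i=1..n. Lnorm \<mu> 2 (\<lambda>x. s i x - p x))
      - 1 / 2 * (\<Sum>i=1..n. Lnorm \<mu> 2 (\<lambda>x. s i x - q x)) + c"
    by (simp add: sum_subtractf sum_distrib_left)
  finally show ?thesis .
qed

text \<open>
  The bound \<open>test\<close> is used twice. For all \<open>q\<close> it bounds the criterion at \<open>p\<close> from above, hence by the
  near minimality of \<open>phat\<close> also the criterion at \<open>phat\<close>. For \<open>q = phat\<close> and by antisymmetry of the tests
  it bounds the criterion at \<open>phat\<close> from below in terms of \<open>S phat\<close>.
\<close>

lemma l2_estimator_risk_le:
  fixes S :: "('a \<Rightarrow> real) \<Rightarrow> real"
  assumes inj: "inj_on (sdensity \<mu>) M" and R: "R > 0" and p: "p \<in> M" and phat: "phat \<in> M"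
    and test: "\<And>q. q \<in> M \<Longrightarrow> 2 * R * (\<Sum>i=1..n. l2_t \<mu> M R (sdensity \<mu> p) (sdensity \<mu> q) (x i))
      \<le> 3 / 2 * S p - 1 / 2 * S q + c"
    and J: "\<And>q. q \<in> M \<Longrightarrow> J \<le> S q"
    and est: "l2_T \<mu> M R n x (sdensity \<mu> phat)
      \<le> (INF P\<in>sdensity \<mu> ` M. l2_T \<mu> M R n x P) + ereal \<epsilon>"
  shows "S phat \<le> 6 * S p - J + 4 * c + 4 * R * \<epsilon>"
proof -
  define u where "u q = (\<Sum>i=1..n. l2_t \<mu> M R (sdensity \<mu> p) (sdensity \<mu> q) (x i))" for q
  have u_le: "u q \<le> (3 / 2 * S p - 1 / 2 * S q + c) / (2 * R)" if "q \<in> M" for q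
    using test[OF that] R by (simp add: u_def field_simps)
  have "ereal (- u phat) \<le> l2_T \<mu> M R n x (sdensity \<mu> phat)"
    unfolding l2_T_def
    by (rule SUP_upper2[of "sdensity \<mu> p"])
       (use p in \<open>simp_all add: u_def l2_t_commute[OF inj p phat] sum_negf\<close>)
  also have "\<dots> \<le> l2_T \<mu> M R n x (sdensity \<mu> p) + ereal \<epsilon>"
    using p by (intro order_trans[OF est] add_right_mono INF_lower) auto
  also have "l2_T \<mu> M R n x (sdensity \<mu> p) \<le> ereal ((3 / 2 * S p - 1 / 2 * J + c) / (2 * R))"
    unfolding l2_T_def
  proof (rule SUP_least)
    fix Q assume "Q \<in> sdensity \<mu> ` M"
    then obtain q where q: "q \<in> M" "Q = sdensity \<mu> q" by auto
    have "u q \<le> (3 / 2 * S p - 1 / 2 * S q + c) / (2 * R)" by (rule u_le[OF q(1)])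
    also have "\<dots> \<le> (3 / 2 * S p - 1 / 2 * J + c) / (2 * R)"
      using J[OF q(1)] R by (intro divide_right_mono) auto
    finally show "ereal (\<Sum>i=1..n. l2_t \<mu> M R (sdensity \<mu> p) Q (x i))
        \<le> ereal ((3 / 2 * S p - 1 / 2 * J + c) / (2 * R))"
      by (simp add: u_def q(2))
  qed
  finally have "- u phat \<le> (3 / 2 * S p - 1 / 2 * J + c) / (2 * R) + \<epsilon>"
    by (simp add: add_right_mono)
  then have "- (2 * R * u phat) \<le> 3 / 2 * S p - 1 / 2 * J + c + 2 * R * \<epsilon>"
    using R by (simp add: field_simps)
  with test[OF phat] show ?thesis by (simp add: u_def)
qed

section \<open>Risk of the estimator\<close>

theorem corollary4:
  fixes \<mu> :: "'a measure" and \<Omega> :: "'w measure"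
    and V M :: "('a \<Rightarrow> real) set" and R \<epsilon> :: real and n :: nat
    and X :: "nat \<Rightarrow> 'w \<Rightarrow> 'a" and pstar :: "nat \<Rightarrow> 'a \<Rightarrow> real"
    and Phat :: "'w \<Rightarrow> 'a smeasure" and phat :: "'w \<Rightarrow> 'a \<Rightarrow> real"
  assumes "sigma_finite_measure \<mu>"
    and "linear_subspace V" and "V \<subseteq> Lspace \<mu> 1 \<inter> Lspace \<mu> 2" and "L2_hilbert \<mu> V"
    and "R > 0" and "\<And>t. t \<in> V \<Longrightarrow> supnorm \<mu> t \<le> ereal (R * Lnorm \<mu> 2 t)"
    and "M \<subseteq> V" and "countable M" and "M \<noteq> {}"
    and "prob_space \<Omega>" and "n \<ge> 1"
    and "prob_space.indep_vars \<Omega> (\<lambda>_. \<mu>) X {1..n}"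
    and "\<And>i. i \<in> {1..n} \<Longrightarrow> pstar i \<in> Lspace \<mu> 2"
    and "\<And>i. i \<in> {1..n} \<Longrightarrow> AE x in \<mu>. 0 \<le> pstar i x"
    and "\<And>i. i \<in> {1..n} \<Longrightarrow> distributed \<Omega> \<mu> (X i) (\<lambda>x. ennreal (pstar i x))"
    and "\<epsilon> > 0"
    and "l2_estimator \<Omega> \<mu> M R \<epsilon> n X Phat"
    and "\<And>\<omega>. \<omega> \<in> space \<Omega> \<Longrightarrow> phat \<omega> \<in> M \<and> Phat \<omega> = sdensity \<mu> (phat \<omega>)"
  shows "\<forall>\<xi>>0. measure \<Omega> {\<omega> \<in> space \<Omega>.
      1 / real n * (\<Sum>i=1..n. Lnorm \<mu> 2 (\<lambda>x. pstar i x - phat \<omega> x))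
      \<le> 5 * (INF p\<in>M. 1 / real n * (\<Sum>i=1..n. Lnorm \<mu> 2 (\<lambda>x. pstar i x - p x)))
         + 4 * R / sqrt (real n) * (1 + sqrt (2 * \<xi>) + \<epsilon> / sqrt (real n))}
    \<ge> 1 - exp (- \<xi>)"
proof (intro allI impI)
  fix \<xi> :: real assume \<xi>: "\<xi> > 0"
  interpret prob_space \<Omega> by fact
  interpret bounded_l2_subspace \<mu> V R
    by (rule bounded_l2_subspace.intro) (use assms(2,3,5,6) in auto)
  have inj: "inj_on (sdensity \<mu>) M"
    using inj_on_subset[OF inj_on_sdensity[of V \<mu>] assms(7)] assms(3,4)
    by (simp add: L2_hilbert_def)
  have M_L2: "M \<subseteq> Lspace \<mu> 2" using assms(3,7) by auto

  define S where "S p = (\<Sum>i=1..n. Lnorm \<mu> 2 (\<lambda>x. pstar i x - p x))" for p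
  define J where "J = (INF p\<in>M. 1 / real n * S p)"
  define c where "c = R * sqrt (real n) * (1 + sqrt (2 * \<xi>))"
  define K where "K = 5 * J + 4 * R / sqrt (real n) * (1 + sqrt (2 * \<xi>) + \<epsilon> / sqrt (real n))"
  have S_nonneg: "0 \<le> S p" for p by (simp add: S_def sum_nonneg Lnorm_2_nonneg)
  have bdd: "bdd_below ((\<lambda>p. 1 / real n * S p) ` M)"
    by (rule bdd_belowI2[where m = 0]) (simp add: S_nonneg)
  have J_le: "real n * J \<le> S q" if "q \<in> M" for q
  proof -
    have "J \<le> 1 / real n * S q" unfolding J_def by (rule cINF_lower[OF bdd that])
    then show ?thesis using \<open>n \<ge> 1\<close> by (simp add: field_simps)
  qed
  have K_eq: "K = 5 * J + (4 * c + 4 * R * \<epsilon>) / real n"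
  proof -
    have "sqrt (real n) * sqrt (real n) = real n" by simp
    moreover have "sqrt (real n) > 0" using \<open>n \<ge> 1\<close> by simp
    ultimately show ?thesis
      unfolding K_def c_def by (simp add: field_simps)
  qed
  define L where "L \<omega> = 1 / real n * S (phat \<omega>)" for \<omega>
  have [measurable]: "L \<in> borel_measurable \<Omega>"
  proof -
    have "(\<lambda>P. 1 / real n * S (dens \<mu> M P)) \<in> borel_measurable (count_space (sdensity \<mu> ` M))"
      by simp
    moreover have "Phat \<in> measurable \<Omega> (count_space (sdensity \<mu> ` M))"
      using assms(17) by (simp add: l2_estimator_def)
    ultimately have "(\<lambda>\<omega>. 1 / real n * S (dens \<mu> M (Phat \<omega>))) \<in> borel_measurable \<Omega>"
      by (rule measurable_compose[rotated])
    then show ?thesis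
      by (rule measurable_cong[THEN iffD1, rotated]) (use assms(18) inj in \<open>simp add: L_def dens_def\<close>)
  qed

  \<comment> \<open>The infimum \<open>J\<close> need not be attained; a comparison density \<open>p\<close> that nearly attains it costs a
    surplus \<open>\<delta>\<close>, removed below by continuity of the measure along \<open>\<delta> \<rightarrow> 0\<close>. As \<open>p\<close> is fixed, the
    test functions form the countable family \<open>F\<close> in the unit ball of \<open>V\<close>.\<close>
  have near: "prob {\<omega> \<in> space \<Omega>. L \<omega> \<le> K + \<delta>} \<ge> 1 - exp (- \<xi>)" if \<delta>: "\<delta> > 0" for \<delta>
  proof -
    \<comment> \<open>\<open>S p\<close> enters the risk bound with the factor 6\<close>
    have "J < J + \<delta> / 6" using \<delta> by simp
    then obtain p where p: "p \<in> M" "1 / real n * S p < J + \<delta> / 6"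
      using \<open>M \<noteq> {}\<close> bdd unfolding J_def by (subst (asm) cINF_less_iff) auto
    define F where "F = unit_diff \<mu> p ` M"
    define bad where "bad = {\<omega> \<in> space \<Omega>. \<exists>f\<in>F. deviation \<Omega> {1..n} X f \<omega> > c}"
    have FV: "F \<subseteq> V"
    proof -
      have "unit_diff \<mu> p q \<in> V" if "q \<in> M" for q
        using cmult_mem[OF diff_mem, of p q "1 / Lnorm \<mu> 2 (\<lambda>y. p y - q y)"] p(1) that assms(7)
        by (auto simp: unit_diff_def[abs_def])
      then show ?thesis by (auto simp: F_def)
    qed
    have nonempty: "{1..n} \<noteq> {}" and card_n: "card {1..n} = n"
      using \<open>n \<ge> 1\<close> by simp_all
    have countable_F: "countable F" using assms(8) by (simp add: F_def)
    have norm_F: "Lnorm \<mu> 2 f \<le> 1" if "f \<in> F" for f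
      using that Lnorm_unit_diff_le by (auto simp: F_def)
    note bound = countable_deviation_bound[OF assms(10) finite_atLeastAtMost nonempty assms(12)
        countable_F FV norm_F \<xi>, unfolded card_n]
    \<comment> \<open>outside \<open>bad\<close> the statistics of \<open>p\<close> against all \<open>q \<in> M\<close> exceed their means by at most \<open>c / (2 * R)\<close>\<close>
    have bad: "bad \<in> sets \<Omega>" "prob bad \<le> exp (- \<xi>)"
      unfolding bad_def c_def by (rule bound; assumption)+
    have "space \<Omega> - bad \<subseteq> {\<omega> \<in> space \<Omega>. L \<omega> \<le> K + \<delta>}"
    proof safe
      fix \<omega> assume \<omega>: "\<omega> \<in> space \<Omega>" "\<omega> \<notin> bad"
      have "S (phat \<omega>) \<le> 6 * S p - real n * J + 4 * c + 4 * R * \<epsilon>"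
      proof (rule l2_estimator_risk_le[OF inj \<open>R > 0\<close> p(1)])
        show "phat \<omega> \<in> M" using assms(18) \<omega> by simp
        show "real n * J \<le> S q" if "q \<in> M" for q by (rule J_le[OF that])
        show "l2_T \<mu> M R n (\<lambda>i. X i \<omega>) (sdensity \<mu> (phat \<omega>))
            \<le> (INF P\<in>sdensity \<mu> ` M. l2_T \<mu> M R n (\<lambda>i. X i \<omega>) P) + ereal \<epsilon>"
          using assms(17,18) \<omega> by (auto simp: l2_estimator_def)
        fix q assume q: "q \<in> M"
        then have "deviation \<Omega> {1..n} X (unit_diff \<mu> p q) \<omega> \<le> c"
          using \<omega> by (auto simp: bad_def F_def)
        then show "2 * R * (\<Sum>i=1..n. l2_t \<mu> M R (sdensity \<mu> p) (sdensity \<mu> q) (X i \<omega>))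
            \<le> 3 / 2 * S p - 1 / 2 * S q + c"
          unfolding S_def
            by (intro l2_t_sum_le[where \<Omega> = \<Omega>] inj M_L2 p(1) q assms(5,13-15))
      qed
      then have "L \<omega> \<le> (6 * S p - real n * J + 4 * c + 4 * R * \<epsilon>) / real n"
        by (simp add: L_def divide_right_mono)
      also have "\<dots> = 6 * (1 / real n * S p) - J + (4 * c + 4 * R * \<epsilon>) / real n"
        using \<open>n \<ge> 1\<close> by (simp add: field_simps)
      finally have "L \<omega> \<le> 6 * (1 / real n * S p) - J + (4 * c + 4 * R * \<epsilon>) / real n" .
      with p(2) show "L \<omega> \<le> K + \<delta>" unfolding K_eq by linarith
    qed
    then have "prob (space \<Omega> - bad) \<le> prob {\<omega> \<in> space \<Omega>. L \<omega> \<le> K + \<delta>}"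
      by (intro finite_measure_mono) auto
    with bad show ?thesis by (simp add: prob_compl)
  qed

  define A where "A k = {\<omega> \<in> space \<Omega>. L \<omega> \<le> K + 1 / real (Suc k)}" for k
  have "(\<lambda>k. prob (A k)) \<longlonglongrightarrow> prob (\<Inter>k. A k)"
  proof (rule finite_Lim_measure_decseq)
    show "range A \<subseteq> sets \<Omega>" unfolding A_def by auto
    show "decseq A"
      unfolding decseq_def
    proof safe
      fix k l :: nat and \<omega> assume "k \<le> l" "\<omega> \<in> A l"
      moreover from \<open>k \<le> l\<close> have "1 / real (Suc l) \<le> 1 / real (Suc k)"
        by (intro divide_left_mono) auto
      ultimately show "\<omega> \<in> A k" by (auto simp: A_def)
    qed
  qed
  moreover have "(\<Inter>k. A k) = {\<omega> \<in> space \<Omega>. L \<omega> \<le> K}"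
  proof safe
    fix \<omega> assume \<omega>: "\<omega> \<in> (\<Inter>k. A k)"
    then show "\<omega> \<in> space \<Omega>" by (auto simp: A_def)
    have "(\<lambda>k. K + 1 / real (Suc k)) \<longlonglongrightarrow> K + 0"
      by (intro tendsto_add tendsto_const) (rule LIMSEQ_Suc[OF lim_1_over_n])
    then show "L \<omega> \<le> K"
      using \<omega> by (intro LIMSEQ_le_const[of _ K]) (auto simp: A_def)
  next
    fix \<omega> k assume "\<omega> \<in> space \<Omega>" "L \<omega> \<le> K"
    then show "\<omega> \<in> A k" by (auto simp: A_def intro: order_trans)
  qed
  moreover have "1 - exp (- \<xi>) \<le> prob (A k)" for k
    unfolding A_def by (rule near) simp
  ultimately have "1 - exp (- \<xi>) \<le> prob {\<omega> \<in> space \<Omega>. L \<omega> \<le> K}"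
    by (intro LIMSEQ_le_const[of "\<lambda>k. prob (A k)"]) auto
  then show "1 - exp (- \<xi>) \<le> prob {\<omega> \<in> space \<Omega>.
      1 / real n * (\<Sum>i=1..n. Lnorm \<mu> 2 (\<lambda>x. pstar i x - phat \<omega> x))
      \<le> 5 * (INF p\<in>M. 1 / real n * (\<Sum>i=1..n. Lnorm \<mu> 2 (\<lambda>x. pstar i x - p x)))
         + 4 * R / sqrt (real n) * (1 + sqrt (2 * \<xi>) + \<epsilon> / sqrt (real n))}"
    by (simp add: L_def K_def J_def S_def)
qed

end
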